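(* For any integer $r\geq1$, $$ gr_r(K_3: B_3^+)= \begin{cases} 17^{r/2}+1, & \text{if $r$ is even,}\\ 4 \cdot 17^{(r - 1)/2}+1, & \text{if $r$ is odd.} \end{cases} $$
   Context: All graphs are finite and simple. A Gallai coloring is an edge coloring of a complete graph containing no rainbow triangle (a triangle whose three edges receive three distinct colors). $gr_r(K_3:H)$ denotes the smallest integer $n$ such that every Gallai coloring of the edges of $K_n$ with colors from $\{1,\dots,r\}$ contains a monochromatic copy of $H$. $B_3^+$ is the graph obtained from the book graph $B_3=K_2\vee\overline{K_3}$ (three triangles sharing a common edge; 5 vertices, 7 edges) by adding one edge between two of its vertices of degree two; it has 5 vertices and 8 edges. *)

theory Defs
  imports "HOL-Library.Ramsey"
begin

text \<open>A graph is a pair of a vertex set and a set of edges, an edge being a two-element set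
  of vertices. \<^term>\<open>nsets A 2\<close>, written \<open>[A]\<^bsup>2\<^esup>\<close>, is the set of all two-element subsets
  of \<open>A\<close>.\<close>

type_synonym 'a graph = "'a set \<times> 'a set set"

definition verts :: "'a graph \<Rightarrow> 'a set" where
  "verts G = fst G"

definition edges :: "'a graph \<Rightarrow> 'a set set" where
  "edges G = snd G"

definition finite_simple_graph :: "'a graph \<Rightarrow> bool" where
  "finite_simple_graph G \<longleftrightarrow> finite (verts G) \<and> edges G \<subseteq> [verts G]\<^bsup>2\<^esup>"

definition complete_graph :: "'a set \<Rightarrow> 'a graph" where
  "complete_graph V = (V, [V]\<^bsup>2\<^esup>)"

definition empty_graph :: "'a set \<Rightarrow> 'a graph" where
  "empty_graph V = (V, {})"

text \<open>The join, to be used for graphs on disjoint vertex sets.\<close>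

definition graph_join :: "'a graph \<Rightarrow> 'a graph \<Rightarrow> 'a graph" where
  "graph_join G H =
     (verts G \<union> verts H, edges G \<union> edges H \<union> {{u, v} |u v. u \<in> verts G \<and> v \<in> verts H})"

definition book3 :: "nat graph" where
  "book3 = graph_join (complete_graph {0, 1}) (empty_graph {2, 3, 4})"

definition book3_plus :: "nat graph" where
  "book3_plus = (verts book3, insert {2, 3} (edges book3))"

definition rainbow_triangle :: "('a set \<Rightarrow> nat) \<Rightarrow> 'a \<Rightarrow> 'a \<Rightarrow> 'a \<Rightarrow> bool" where
  "rainbow_triangle c x y z \<longleftrightarrow>
     x \<noteq> y \<and> y \<noteq> z \<and> x \<noteq> z \<and>
     c {x, y} \<noteq> c {y, z} \<and> c {y, z} \<noteq> c {x, z} \<and> c {x, y} \<noteq> c {x, z}"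

text \<open>A colouring need not use all \<open>r\<close> colours; its values outside \<open>[V]\<^bsup>2\<^esup>\<close> are irrelevant.\<close>

definition gallai_coloring :: "nat \<Rightarrow> 'a set \<Rightarrow> ('a set \<Rightarrow> nat) \<Rightarrow> bool" where
  "gallai_coloring r V c \<longleftrightarrow>
     c \<in> edges (complete_graph V) \<rightarrow> {1..r} \<and>
     \<not> (\<exists>x\<in>V. \<exists>y\<in>V. \<exists>z\<in>V. rainbow_triangle c x y z)"

text \<open>Copies are subgraphs, not necessarily induced.\<close>

definition has_mono_copy :: "nat \<Rightarrow> 'a set \<Rightarrow> ('a set \<Rightarrow> nat) \<Rightarrow> 'b graph \<Rightarrow> bool" where
  "has_mono_copy r V c H \<longleftrightarrow>
     (\<exists>k\<in>{1..r}. \<exists>f. inj_on f (verts H) \<and> f ` verts H \<subseteq> V \<and> (\<forall>e\<in>edges H. c (f ` e) = k))"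

definition gallai_ramsey :: "nat \<Rightarrow> 'b graph \<Rightarrow> nat" where
  "gallai_ramsey r H =
     (LEAST n. \<forall>c. gallai_coloring r {..<n} c \<longrightarrow> has_mono_copy r {..<n} c H)"

lemma verts_book3_plus: "verts book3_plus = {0, 1, 2, 3, 4}"
  by (auto simp: book3_plus_def book3_def graph_join_def complete_graph_def empty_graph_def verts_def)

lemma edges_book3_plus:
  "edges book3_plus = {{2, 3}, {0, 1}, {0, 2}, {0, 3}, {0, 4}, {1, 2}, {1, 3}, {1, 4}}"
proof -
  have "[{0, 1::nat}]\<^bsup>2\<^esup> = {{0, 1}}"
    by (auto simp: nsets_def card_2_iff)
  moreover have "{{u, v} |u v. u \<in> U \<and> v \<in> V} = (\<Union>u\<in>U. (\<lambda>v. {u, v}) ` V)" for U V :: "nat set"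
    by blast
  ultimately show ?thesis
    unfolding book3_plus_def book3_def graph_join_def complete_graph_def empty_graph_def
      verts_def edges_def
    by (simp only: fst_conv snd_conv Union_insert Union_empty image_insert image_empty
        Un_insert_left Un_empty_left Un_empty_right)
qed

lemma card_edges_book3_plus: "card (edges book3_plus) = 8"
  by (simp add: edges_book3_plus doubleton_eq_iff)

lemma finite_simple_graph_book3_plus: "finite_simple_graph book3_plus"
  by (simp add: finite_simple_graph_def verts_book3_plus edges_book3_plus nsets_def)

end

theory Submission
  imports Defs
begin

text \<open>Lower bound: the Paley colouring of \<open>K\<^bsub>17\<^esub>\<close> has no monochromatic \<open>K\<^sub>4\<close>, so substituting
  a colouring with \<open>r\<close> colours for each of its vertices gives a factor 17 for two further colours.

  Upper bound: call a colour a book colour if it contains no \<open>B\<^sub>3\<^sup>+\<close>, and a triangle colour if it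
  contains not even a triangle. With \<open>a\<close> book colours and \<open>b\<close> triangle colours a Gallai colouring
  has at most \<open>\<alpha>\<^sub>a \<beta>\<^sub>b\<close> vertices, where \<open>\<alpha>\<close> grows by the factor 17 and \<open>\<beta>\<close> by the factor 5
  in every second step. The proof is by induction on the number of vertices along a Gallai partition.
  A class that is joined in a book colour to a vertex contains no paw (triangle with a pendant edge) in
  that colour, and one that is joined to two vertices contains no triangle in it. Thus inside the
  classes book colours become triangle colours and triangle colours disappear, up to the disjoint
  triangles allowed in a paw-free graph. The number of classes is bounded by two-colour Ramsey numbers
  (6 for two triangles, 9 for triangle against \<open>B\<^sub>3\<^sup>+\<close>, 18 for \<open>B\<^sub>3\<^sup>+\<close> against itself).\<close>

section \<open>Two-colour Ramsey numbers\<close>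

locale sym_coloring =
  fixes c :: "'a \<Rightarrow> 'a \<Rightarrow> 'k"
  assumes c_sym: "c x y = c y x"
begin

definition coloured_in :: "'k set \<Rightarrow> 'a set \<Rightarrow> bool" where
  "coloured_in K S \<longleftrightarrow> (\<forall>x\<in>S. \<forall>y\<in>S. x \<noteq> y \<longrightarrow> c x y \<in> K)"

definition edge_free :: "'k \<Rightarrow> 'a set \<Rightarrow> bool" where
  "edge_free i S \<longleftrightarrow> (\<forall>x\<in>S. \<forall>y\<in>S. x \<noteq> y \<longrightarrow> c x y \<noteq> i)"

definition triangle_free :: "'k \<Rightarrow> 'a set \<Rightarrow> bool" where
  "triangle_free i S \<longleftrightarrow> (\<forall>x\<in>S. \<forall>y\<in>S. \<forall>z\<in>S. x \<noteq> y \<and> x \<noteq> z \<and> y \<noteq> z \<longrightarrow>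
     \<not> (c x y = i \<and> c x z = i \<and> c y z = i))"

text \<open>The paw is a triangle \<open>b\<close>, \<open>x\<close>, \<open>y\<close> with a pendant edge from \<open>b\<close> to \<open>z\<close>.\<close>

definition paw_free :: "'k \<Rightarrow> 'a set \<Rightarrow> bool" where
  "paw_free i S \<longleftrightarrow> (\<forall>b\<in>S. \<forall>x\<in>S. \<forall>y\<in>S. \<forall>z\<in>S. distinct [b, x, y, z] \<longrightarrow>
     \<not> (c b x = i \<and> c b y = i \<and> c x y = i \<and> c b z = i))"

text \<open>\<open>B_3^+\<close> is read as spine \<open>a b\<close>, pages \<open>x\<close>,
  \<open>y\<close>, \<open>z\<close> and extra edge \<open>x y\<close>; equivalently, a
  \<open>K_4\<close> on \<open>a\<close>, \<open>b\<close>, \<open>x\<close>, \<open>y\<close> with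
  \<open>z\<close> adjacent to two of its vertices.\<close>

definition book_free :: "'k \<Rightarrow> 'a set \<Rightarrow> bool" where
  "book_free i S \<longleftrightarrow> (\<forall>a\<in>S. \<forall>b\<in>S. \<forall>x\<in>S. \<forall>y\<in>S. \<forall>z\<in>S. distinct [a, b, x, y, z] \<longrightarrow>
     \<not> (c a b = i \<and> c a x = i \<and> c a y = i \<and> c a z = i \<and> c b x = i \<and> c b y = i \<and> c b z = i \<and> c x y = i))"

definition joined :: "'k \<Rightarrow> 'a set \<Rightarrow> 'a set \<Rightarrow> bool" where
  "joined i X Y \<longleftrightarrow> X \<inter> Y = {} \<and> (\<forall>x\<in>X. \<forall>y\<in>Y. c x y = i)"

lemma coloured_in_subset: "coloured_in K S \<Longrightarrow> T \<subseteq> S \<Longrightarrow> coloured_in K T"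
  unfolding coloured_in_def by blast

lemma triangle_free_subset: "triangle_free i S \<Longrightarrow> T \<subseteq> S \<Longrightarrow> triangle_free i T"
  unfolding triangle_free_def by blast

lemma paw_free_subset: "paw_free i S \<Longrightarrow> T \<subseteq> S \<Longrightarrow> paw_free i T"
  unfolding paw_free_def by blast

lemma book_free_subset: "book_free i S \<Longrightarrow> T \<subseteq> S \<Longrightarrow> book_free i T"
  unfolding book_free_def by blast

lemma coloured_inD: "coloured_in K S \<Longrightarrow> x \<in> S \<Longrightarrow> y \<in> S \<Longrightarrow> x \<noteq> y \<Longrightarrow> c x y \<in> K"
  unfolding coloured_in_def by blast

lemma edge_freeD: "edge_free i S \<Longrightarrow> x \<in> S \<Longrightarrow> y \<in> S \<Longrightarrow> x \<noteq> y \<Longrightarrow> c x y \<noteq> i"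
  unfolding edge_free_def by blast

lemma not_edge_freeE:
  assumes "\<not> edge_free i S"
  obtains x y where "x \<in> S" "y \<in> S" "x \<noteq> y" "c x y = i"
  using assms unfolding edge_free_def by blast

lemma triangle_freeD:
  "triangle_free i S \<Longrightarrow> x \<in> S \<Longrightarrow> y \<in> S \<Longrightarrow> z \<in> S \<Longrightarrow> x \<noteq> y \<Longrightarrow> x \<noteq> z \<Longrightarrow> y \<noteq> z \<Longrightarrow>
   c x y = i \<Longrightarrow> c x z = i \<Longrightarrow> c y z = i \<Longrightarrow> False"
  unfolding triangle_free_def by blast

lemma not_triangle_freeE:
  assumes "\<not> triangle_free i S"
  obtains x y z where "x \<in> S" "y \<in> S" "z \<in> S" "x \<noteq> y" "x \<noteq> z" "y \<noteq> z"
    "c x y = i" "c x z = i" "c y z = i"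
  using assms that unfolding triangle_free_def by metis

lemma paw_freeD:
  "paw_free i S \<Longrightarrow> b \<in> S \<Longrightarrow> x \<in> S \<Longrightarrow> y \<in> S \<Longrightarrow> z \<in> S \<Longrightarrow> distinct [b, x, y, z] \<Longrightarrow>
   c b x = i \<Longrightarrow> c b y = i \<Longrightarrow> c x y = i \<Longrightarrow> c b z \<noteq> i"
  unfolding paw_free_def by blast

lemma book_freeD:
  "book_free i S \<Longrightarrow> {a, b, x, y, z} \<subseteq> S \<Longrightarrow> distinct [a, b, x, y, z] \<Longrightarrow> c a b = i \<Longrightarrow>
   c a x = i \<Longrightarrow> c a y = i \<Longrightarrow> c a z = i \<Longrightarrow> c b x = i \<Longrightarrow> c b y = i \<Longrightarrow> c b z = i \<Longrightarrow> c x y = i \<Longrightarrow> False"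
  unfolding book_free_def by (metis insert_subset)

lemma joined_sym: "joined i X Y \<longleftrightarrow> joined i Y X"
  unfolding joined_def by (auto simp: c_sym Int_commute) (metis c_sym)+

lemma joinedD:
  assumes "joined i X Y" "x \<in> X" "y \<in> Y"
  shows "c x y = i" "c y x = i" "x \<noteq> y" "y \<noteq> x"
  using assms c_sym[of x y] unfolding joined_def by auto

text \<open>A vertex adjacent in colour \<open>i\<close> to all of a paw completes it to
  \<open>B_3^+\<close>: this vertex and the centre of the paw form the spine.\<close>

lemma joined_imp_paw_free:
  assumes "joined i X Y" "book_free i (X \<union> Y)" "y \<in> Y"
  shows "paw_free i X"
  unfolding paw_free_def
proof (intro ballI impI notI)
  fix b u v w assume "b \<in> X" "u \<in> X" "v \<in> X" "w \<in> X" "distinct [b, u, v, w]"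
    "c b u = i \<and> c b v = i \<and> c u v = i \<and> c b w = i"
  then show False
    using assms(3) joinedD[OF assms(1) _ assms(3)] book_freeD[OF assms(2), of y b u v w] by auto
qed

text \<open>A triangle with two common neighbours contains \<open>B_3^+\<close>: the edge
  \<open>u v\<close> is the spine, \<open>w\<close>, \<open>y\<close>, \<open>y'\<close> are the
  pages and \<open>w y\<close> is the extra edge.\<close>

lemma joined_imp_triangle_free:
  assumes "joined i X Y" "book_free i (X \<union> Y)" "y \<in> Y" "y' \<in> Y" "y \<noteq> y'"
  shows "triangle_free i X"
proof (rule ccontr)
  assume "\<not> triangle_free i X"
  then obtain u v w where "u \<in> X" "v \<in> X" "w \<in> X" "u \<noteq> v" "u \<noteq> w" "v \<noteq> w"
    "c u v = i" "c u w = i" "c v w = i"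
    by (rule not_triangle_freeE)
  then show False
    using assms(3-5) joinedD[OF assms(1)] book_freeD[OF assms(2), of u v y w y'] by auto
qed

text \<open>With edges on both sides, \<open>a b\<close> in \<open>Y\<close> would be the spine,
  \<open>u\<close>, \<open>v\<close> and any third vertex of \<open>X\<close> the pages, and
  \<open>u v\<close> the extra edge.\<close>

lemma joined_imp_edge_free:
  assumes "joined i X Y" "book_free i (X \<union> Y)" "\<not> edge_free i Y" "card X \<ge> 3"
  shows "edge_free i X"
proof (rule ccontr)
  assume "\<not> edge_free i X"
  then obtain u v where uv: "u \<in> X" "v \<in> X" "u \<noteq> v" "c u v = i" by (rule not_edge_freeE)
  obtain a b where ab: "a \<in> Y" "b \<in> Y" "a \<noteq> b" "c a b = i" using assms(3) by (rule not_edge_freeE)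
  have "\<not> X \<subseteq> {u, v}"
    using assms(4) card_mono[of "{u, v}" X] by (auto simp: card_insert_if split: if_splits)
  then obtain w where "w \<in> X" "w \<noteq> u" "w \<noteq> v" by blast
  then show False
    using uv ab joinedD[OF assms(1)] book_freeD[OF assms(2), of a b u v w] by auto
qed

lemma joined_singletonI: "(\<And>x. x \<in> X \<Longrightarrow> x \<noteq> v \<and> c v x = i) \<Longrightarrow> joined i X {v}"
  unfolding joined_def using c_sym by auto

section \<open>Triangles against triangles, \<open>K_4\<close>, books and paws\<close>

lemma book_free_imp_clique_small:
  assumes "book_free i S" "coloured_in {i} S" "finite S"
  shows "card S \<le> 4"
proof (rule ccontr)
  assume "\<not> card S \<le> 4"
  then obtain T where "T \<subseteq> S" "card T = 5" "finite T"
    by (metis not_less_eq_eq obtain_subset_with_card_n eval_nat_numeral(3) numeral_code(2))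
  then obtain xs where xs: "set xs \<subseteq> S" "distinct xs" "length xs = 5"
    by (metis finite_distinct_list distinct_card)
  then obtain a b x y z where "xs = [a, b, x, y, z]"
    by (auto simp: length_Suc_conv eval_nat_numeral)
  then show False
    using xs book_freeD[OF assms(1), of a b x y z] coloured_inD[OF assms(2)] by simp
qed

lemma two_colour_pigeonhole:
  assumes "finite S" "coloured_in {i, j} S" "v \<in> S" "card S \<ge> p + q + 2"
  obtains "card {x \<in> S. x \<noteq> v \<and> c v x = i} \<ge> p + 1"
  | "card {x \<in> S. x \<noteq> v \<and> c v x = j} \<ge> q + 1"
proof -
  let ?I = "{x \<in> S. x \<noteq> v \<and> c v x = i}" and ?J = "{x \<in> S. x \<noteq> v \<and> c v x = j}"
  have "S - {v} \<subseteq> ?I \<union> ?J"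
    using coloured_inD[OF assms(2)] assms(3) by blast
  then have "card (S - {v}) \<le> card ?I + card ?J"
    using card_mono[of "?I \<union> ?J" "S - {v}"] card_Un_le[of ?I ?J] assms(1) by simp
  moreover have "card (S - {v}) = card S - 1"
    using assms by simp
  ultimately have "card ?I \<ge> p + 1 \<or> card ?J \<ge> q + 1"
    using assms(4) by linarith
  then show ?thesis using that by blast
qed

lemma triangle_free_imp_nbhd_edge_free:
  assumes "triangle_free i S" "v \<in> S"
  shows "edge_free i {x \<in> S. x \<noteq> v \<and> c v x = i}"
  unfolding edge_free_def using triangle_freeD[OF assms(1,2)] by blast

lemma coloured_in_edge_free:
  "coloured_in {i, j} S \<Longrightarrow> edge_free i S \<Longrightarrow> coloured_in {j} S"
  unfolding coloured_in_def edge_free_def by blast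

lemma coloured_in_swap: "coloured_in {i, j} S \<Longrightarrow> coloured_in {j, i} S"
  by (simp add: insert_commute)

lemma clique_triangle_free_small:
  assumes "coloured_in {i} S" "triangle_free i S" "finite S"
  shows "card S \<le> 2"
proof (rule ccontr)
  assume "\<not> card S \<le> 2"
  then obtain T where "T \<subseteq> S" "card T = 3"
    by (metis not_less_eq_eq obtain_subset_with_card_n eval_nat_numeral(3) numeral_code(2))
  then obtain x y z where "T = {x, y, z}" "x \<noteq> y" "x \<noteq> z" "y \<noteq> z"
    by (auto simp: card_3_iff)
  then show False
    using \<open>T \<subseteq> S\<close> triangle_freeD[OF assms(2), of x y z] coloured_inD[OF assms(1)] by simp
qed

text \<open>The neighbourhood spans no edge of colour \<open>i\<close>, hence is a clique in colour
  \<open>j\<close>, where a third vertex would give a triangle. Both degree bounds together yield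
  \<open>R(3,3) <= 6\<close>.\<close>

lemma ramsey_triangle_triangle_aux:
  assumes "finite S" "coloured_in {i, j} S" "triangle_free i S" "triangle_free j S" "v \<in> S"
  shows "card {x \<in> S. x \<noteq> v \<and> c v x = i} \<le> 2"
proof (rule clique_triangle_free_small)
  show "coloured_in {j} {x \<in> S. x \<noteq> v \<and> c v x = i}"
    by (rule coloured_in_edge_free[OF coloured_in_subset[OF assms(2)]
          triangle_free_imp_nbhd_edge_free[OF assms(3,5)]]) blast
  show "triangle_free j {x \<in> S. x \<noteq> v \<and> c v x = i}"
    by (rule triangle_free_subset[OF assms(4)]) blast
qed (use assms in simp)

lemma ramsey_triangle_triangle:
  assumes "finite S" "coloured_in {i, j} S" "triangle_free i S" "triangle_free j S"
  shows "card S \<le> 5"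
proof (rule ccontr)
  assume "\<not> card S \<le> 5"
  then have "S \<noteq> {}" by auto
  then obtain v where v: "v \<in> S" by blast
  have "card S \<ge> 2 + 2 + 2" using \<open>\<not> card S \<le> 5\<close> by linarith
  from two_colour_pigeonhole[OF assms(1,2) v this] show False
    using ramsey_triangle_triangle_aux[OF assms v]
      ramsey_triangle_triangle_aux[OF assms(1) coloured_in_swap[OF assms(2)] assms(4,3) v]
    by cases simp_all
qed

text \<open>Handshake lemma: the incidences of vertices and edges of colour \<open>i\<close> are
  counted in two ways. It excludes a 3-regular graph on nine vertices in the next lemma.\<close>

lemma sum_degree_even:
  assumes "finite S"
  shows "even (\<Sum>v\<in>S. card {x \<in> S. x \<noteq> v \<and> c v x = i})"
proof -
  let ?E = "{e. \<exists>x\<in>S. \<exists>y\<in>S. x \<noteq> y \<and> c x y = i \<and> e = {x, y}}"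
  have fin: "finite ?E"
    by (rule finite_subset[of _ "Pow S"]) (use assms in auto)
  have deg: "card {x \<in> S. x \<noteq> v \<and> c v x = i} = card {e \<in> ?E. v \<in> e}" if "v \<in> S" for v
  proof (rule bij_betw_same_card)
    show "bij_betw (\<lambda>x. {v, x}) {x \<in> S. x \<noteq> v \<and> c v x = i} {e \<in> ?E. v \<in> e}"
      unfolding bij_betw_def
    proof
      show "inj_on (\<lambda>x. {v, x}) {x \<in> S. x \<noteq> v \<and> c v x = i}"
        by (auto simp: inj_on_def doubleton_eq_iff)
      show "(\<lambda>x. {v, x}) ` {x \<in> S. x \<noteq> v \<and> c v x = i} = {e \<in> ?E. v \<in> e}"
      proof (intro equalityI subsetI)
        fix e assume "e \<in> (\<lambda>x. {v, x}) ` {x \<in> S. x \<noteq> v \<and> c v x = i}"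
        then obtain x where x: "x \<in> S" "x \<noteq> v" "c v x = i" "e = {v, x}" by blast
        have "e \<in> ?E" by (intro CollectI bexI[of _ v] bexI[of _ x]) (use x that in auto)
        then show "e \<in> {e \<in> ?E. v \<in> e}" using x(4) by blast
      next
        fix e assume "e \<in> {e \<in> ?E. v \<in> e}"
        then obtain x y where xy: "x \<in> S" "y \<in> S" "x \<noteq> y" "c x y = i" "e = {x, y}" "v \<in> e"
          by blast
        have "c y x = i" using xy(4) c_sym by metis
        from xy consider "v = x" | "v = y" by blast
        then show "e \<in> (\<lambda>x. {v, x}) ` {x \<in> S. x \<noteq> v \<and> c v x = i}"
          by cases (use xy \<open>c y x = i\<close> in auto)
      qed
    qed
  qed
  have "card {v \<in> S. v \<in> e} = 2" if "e \<in> ?E" for e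
  proof -
    from that obtain x y where "x \<in> S" "y \<in> S" "x \<noteq> y" "e = {x, y}" by blast
    then have "{v \<in> S. v \<in> e} = {x, y}" by blast
    then show ?thesis using \<open>x \<noteq> y\<close> by simp
  qed
  then have "(\<Sum>v\<in>S. card {e \<in> ?E. v \<in> e}) = (\<Sum>e\<in>?E. 2)"
    using sum_multicount_gen[OF assms fin, of "\<lambda>v e. v \<in> e" "\<lambda>_. 2"] by blast
  then show ?thesis using deg by simp
qed

text \<open>The classical argument for \<open>R(3,4) <= 9\<close>. Parity excludes that all degrees
  in colour \<open>i\<close> are 3. A degree of at least 4 gives a \<open>j\<close>-clique as
  neighbourhood; a degree of at most 2 leaves six \<open>j\<close>-neighbours, among which
  \<open>R(3,3) <= 6\<close> yields a \<open>j\<close>-triangle that extends by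
  \<open>v\<close>.\<close>

lemma ramsey_triangle_K4:
  assumes "finite S" "card S = 9" "coloured_in {i, j} S" "triangle_free i S"
  obtains Q where "Q \<subseteq> S" "card Q = 4" "coloured_in {j} Q"
proof (cases "\<forall>v\<in>S. card {x \<in> S. x \<noteq> v \<and> c v x = i} = 3")
  case True
  then have "(\<Sum>v\<in>S. card {x \<in> S. x \<noteq> v \<and> c v x = i}) = 27" using assms(2) by simp
  then show ?thesis using sum_degree_even[OF assms(1), of i] by simp
next
  case False
  then obtain v where v: "v \<in> S" "card {x \<in> S. x \<noteq> v \<and> c v x = i} \<noteq> 3" by blast
  let ?I = "{x \<in> S. x \<noteq> v \<and> c v x = i}" and ?J = "{x \<in> S. x \<noteq> v \<and> c v x = j}"
  have ce: "coloured_in {j} ?I"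
    by (rule coloured_in_edge_free[OF coloured_in_subset[OF assms(3)]
          triangle_free_imp_nbhd_edge_free[OF assms(4) v(1)]]) blast
  show ?thesis
  proof (cases "card ?I \<ge> 4")
    case True
    then obtain Q where "Q \<subseteq> ?I" "card Q = 4" by (rule obtain_subset_with_card_n)
    then show ?thesis using that coloured_in_subset[OF ce] by blast
  next
    case False
    then have small: "card ?I < 2 + 1" using v(2) by linarith
    have "card S \<ge> 2 + 5 + 2" using assms(2) by simp
    from two_colour_pigeonhole[OF assms(1,3) v(1) this] have "card ?J \<ge> 6"
      using small by cases auto
    then have "\<not> triangle_free j ?J"
      using ramsey_triangle_triangle[of ?J i j] assms(1) coloured_in_subset[OF assms(3), of ?J]
        triangle_free_subset[OF assms(4), of ?J] by auto
    then obtain x y z where xyz: "x \<in> ?J" "y \<in> ?J" "z \<in> ?J" "x \<noteq> y" "x \<noteq> z" "y \<noteq> z"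
      "c x y = j" "c x z = j" "c y z = j"
      by (rule not_triangle_freeE)
    show ?thesis
    proof (rule that[of "{v, x, y, z}"])
      show "coloured_in {j} {v, x, y, z}"
        using xyz c_sym unfolding coloured_in_def by auto
    qed (use xyz v in auto)
  qed
qed

text \<open>Two \<open>j\<close>-neighbours of \<open>x\<close> in the clique would serve as spine,
  with \<open>x\<close> and the two remaining vertices of \<open>Q\<close> as pages.\<close>

lemma book_free_K4_nbhd:
  assumes "book_free j S" "Q \<subseteq> S" "card Q = 4" "coloured_in {j} Q" "x \<in> S - Q"
  shows "card {q \<in> Q. c q x = j} \<le> 1"
proof (rule ccontr)
  assume "\<not> card {q \<in> Q. c q x = j} \<le> 1"
  then have "card {q \<in> Q. c q x = j} \<ge> 2" by simp
  then obtain P where P: "P \<subseteq> {q \<in> Q. c q x = j}" "card P = 2"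
    by (rule obtain_subset_with_card_n)
  then obtain a b where ab: "P = {a, b}" "a \<noteq> b" by (auto simp: card_2_iff)
  have "finite Q" using assms(3) by (metis card.infinite zero_neq_numeral)
  then have "card (Q - {a, b}) = 2" using P ab assms(3) by (simp add: card_Diff_subset)
  then obtain u v where "Q - {a, b} = {u, v}" "u \<noteq> v" by (auto simp: card_2_iff)
  then have uv: "u \<in> Q" "v \<in> Q" "u \<notin> {a, b}" "v \<notin> {a, b}" "u \<noteq> v" by blast+
  then show False
    using book_freeD[OF assms(1), of a b u v x] P ab assms(2,5) coloured_inD[OF assms(4)] by auto
qed

text \<open>Nine vertices contain a \<open>j\<close>-clique \<open>Q\<close> of size 4, and each of
  the other five sends at least three \<open>i\<close>-edges to it. Any two of these share an
  \<open>i\<close>-neighbour in \<open>Q\<close>, so the five span no \<open>i\<close>-edge and form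
  a \<open>K_5\<close> in colour \<open>j\<close>, which contains \<open>B_3^+\<close>.\<close>

lemma ramsey_triangle_book:
  assumes "finite S" "coloured_in {i, j} S" "triangle_free i S" "book_free j S"
  shows "card S \<le> 8"
proof (rule ccontr)
  assume "\<not> card S \<le> 8"
  then have "card S \<ge> 9" by simp
  then obtain T where T: "T \<subseteq> S" "card T = 9" "finite T" by (rule obtain_subset_with_card_n)
  note T' = coloured_in_subset[OF assms(2) T(1)] triangle_free_subset[OF assms(3) T(1)]
    book_free_subset[OF assms(4) T(1)]
  obtain Q where Q: "Q \<subseteq> T" "card Q = 4" "coloured_in {j} Q"
    using ramsey_triangle_K4[OF T(3,2) T'(1,2)] .
  have finQ: "finite Q" using Q(1) T(3) finite_subset by blast
  have big: "card {q \<in> Q. c q x = i} \<ge> 3" if x: "x \<in> T - Q" for x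
  proof -
    have "Q \<subseteq> {q \<in> Q. c q x = i} \<union> {q \<in> Q. c q x = j}"
      using x Q(1) coloured_inD[OF T'(1)] by blast
    then have "4 \<le> card {q \<in> Q. c q x = i} + card {q \<in> Q. c q x = j}"
      using card_mono[of "{q \<in> Q. c q x = i} \<union> {q \<in> Q. c q x = j}" Q] finQ Q(2)
        card_Un_le[of "{q \<in> Q. c q x = i}" "{q \<in> Q. c q x = j}"] by simp
    then show ?thesis using book_free_K4_nbhd[OF T'(3) Q x] by linarith
  qed
  have "edge_free i (T - Q)"
    unfolding edge_free_def
  proof (intro ballI impI notI)
    fix x y assume xy: "x \<in> T - Q" "y \<in> T - Q" "x \<noteq> y" "c x y = i"
    let ?X = "{q \<in> Q. c q x = i}" and ?Y = "{q \<in> Q. c q y = i}"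
    have "?X \<inter> ?Y \<noteq> {}"
    proof
      assume "?X \<inter> ?Y = {}"
      then have "card (?X \<union> ?Y) = card ?X + card ?Y" using finQ by (simp add: card_Un_disjoint)
      moreover have "card (?X \<union> ?Y) \<le> card Q" using finQ by (intro card_mono) auto
      ultimately show False using big[OF xy(1)] big[OF xy(2)] Q(2) by linarith
    qed
    then obtain q where "q \<in> Q" "c q x = i" "c q y = i" by blast
    then show False using triangle_freeD[OF T'(2), of q x y] xy Q(1) by auto
  qed
  then have "coloured_in {j} (T - Q)"
    using coloured_in_edge_free coloured_in_subset[OF T'(1), of "T - Q"] by blast
  then have "card (T - Q) \<le> 4"
    using book_free_imp_clique_small book_free_subset[OF T'(3), of "T - Q"] T(3) by blast
  then show False using Q T finQ by (simp add: card_Diff_subset)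
qed

text \<open>If there is a \<open>j\<close>-triangle, paw-freeness makes its vertex \<open>x\<close>
  adjacent in \<open>i\<close> to everything outside the triangle. The outside then has no
  \<open>i\<close>-edge, so it is a \<open>j\<close>-clique of at most 4 vertices, and 3 + 4 =
  7.\<close>

lemma ramsey_triangle_paw:
  assumes "finite S" "coloured_in {i, j} S" "triangle_free i S" "paw_free j S" "book_free j S"
  shows "card S \<le> 7"
proof (cases "triangle_free j S")
  case True
  then show ?thesis using ramsey_triangle_triangle[OF assms(1-3)] by simp
next
  case False
  then obtain x y z where xyz: "x \<in> S" "y \<in> S" "z \<in> S" "x \<noteq> y" "x \<noteq> z" "y \<noteq> z"
    "c x y = j" "c x z = j" "c y z = j"
    by (rule not_triangle_freeE)
  let ?U = "S - {x, y, z}"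
  have xi: "c x u = i" if "u \<in> ?U" for u
    using that paw_freeD[OF assms(4), of x y z u] xyz coloured_inD[OF assms(2), of x u] by auto
  have "edge_free i ?U"
    unfolding edge_free_def using xi triangle_freeD[OF assms(3), of x] xyz(1) by blast
  then have "card ?U \<le> 4"
    using book_free_imp_clique_small[of j ?U] coloured_in_edge_free[of i j ?U]
      coloured_in_subset[OF assms(2), of ?U] book_free_subset[OF assms(5), of ?U] assms(1) by auto
  moreover have "card ?U = card S - 3" using xyz by (simp add: card_Diff_subset)
  ultimately show ?thesis by linarith
qed

section \<open>\<open>B_3^+\<close> against itself\<close>

lemma paw_free_triangle_rest:
  assumes "paw_free i S" "coloured_in {i, j} S" "x \<in> S" "y \<in> S" "z \<in> S" "x \<noteq> y" "x \<noteq> z" "y \<noteq> z"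
    "c x y = i" "c x z = i" "c y z = i"
  shows "joined j (S - {x, y, z}) {x, y, z}"
  unfolding joined_def
proof (intro conjI ballI)
  fix u t assume u: "u \<in> S - {x, y, z}" and t: "t \<in> {x, y, z}"
  have "c y x = i" "c z x = i" "c z y = i" using assms(9-11) c_sym by metis+
  then have "c t u \<noteq> i"
    using t u assms paw_freeD[OF assms(1), of x y z u] paw_freeD[OF assms(1), of y x z u]
      paw_freeD[OF assms(1), of z x y u] by auto
  moreover have "c t u \<in> {i, j}" using coloured_inD[OF assms(2), of t u] t u assms by auto
  ultimately show "c u t = j" by (simp add: c_sym[of u t])
qed auto

text \<open>Being joined to \<open>v\<close>, the neighbourhood is paw-free in \<open>i\<close>.
  Without an \<open>i\<close>-triangle it has at most 8 vertices. Otherwise its remainder is joined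
  in \<open>j\<close> to that triangle, hence has no \<open>j\<close>-triangle, and the paw bound
  gives 7 + 3 = 10.\<close>

lemma book_free_nbhd_small:
  assumes "finite S" "coloured_in {i, j} S" "book_free i S" "book_free j S" "v \<in> S"
  shows "card {x \<in> S. x \<noteq> v \<and> c v x = i} \<le> 10"
proof -
  let ?N = "{x \<in> S. x \<noteq> v \<and> c v x = i}"
  have N: "?N \<subseteq> S" by blast
  note N' = coloured_in_subset[OF assms(2) N] book_free_subset[OF assms(3) N]
    book_free_subset[OF assms(4) N]
  have jn: "joined i ?N {v}" by (rule joined_singletonI) blast
  have "book_free i (?N \<union> {v})"
    by (rule book_free_subset[OF assms(3)]) (use assms(5) in blast)
  then have paw: "paw_free i ?N" by (rule joined_imp_paw_free[OF jn]) simp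
  show ?thesis
  proof (cases "triangle_free i ?N")
    case True
    have "card ?N \<le> 8"
      by (rule ramsey_triangle_book[OF _ N'(1) True N'(3)]) (use assms(1) in simp)
    then show ?thesis by linarith
  next
    case False
    then obtain x y z where xyz: "x \<in> ?N" "y \<in> ?N" "z \<in> ?N" "x \<noteq> y" "x \<noteq> z" "y \<noteq> z"
      "c x y = i" "c x z = i" "c y z = i"
      by (rule not_triangle_freeE)
    let ?W = "?N - {x, y, z}"
    have jW: "joined j ?W {x, y, z}" by (rule paw_free_triangle_rest[OF paw N'(1) xyz])
    have "book_free j (?W \<union> {x, y, z})"
      by (rule book_free_subset[OF N'(3)]) (use xyz in blast)
    then have "triangle_free j ?W"

      by (rule joined_imp_triangle_free[OF jW, of x y]) (use xyz(4) in simp_all)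
    moreover have sub: "?W \<subseteq> ?N" by blast
    ultimately have "card ?W \<le> 7"
      using ramsey_triangle_paw[of ?W j i] assms(1) paw_free_subset[OF paw sub]
        book_free_subset[OF N'(2) sub] coloured_in_swap[OF coloured_in_subset[OF N'(1) sub]] by simp
    moreover have "card ?W = card ?N - 3" using xyz by (subst card_Diff_subset) auto
    ultimately show ?thesis by linarith
  qed
qed

text \<open>Count the \<open>j\<close>-edges between \<open>Q\<close> and the rest
  \<open>?T\<close>: each vertex of \<open>?T\<close> sends at least 3, each vertex of
  \<open>Q\<close> receives at most 10. So \<open>3 * card ?T <= 40\<close>, hence
  \<open>card ?T <= 13\<close>, and 13 + 4 = 17.\<close>

lemma book_free_K4_total_small:
  assumes "finite S" "coloured_in {i, j} S" "book_free i S" "book_free j S"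
    "Q \<subseteq> S" "card Q = 4" "coloured_in {i} Q"
  shows "card S \<le> 17"
proof -
  have finQ: "finite Q" using assms(1,5) finite_subset by blast
  let ?T = "S - Q"
  have ge: "card {q \<in> Q. c q x = j} \<ge> 3" if x: "x \<in> ?T" for x
  proof -
    have "Q \<subseteq> {q \<in> Q. c q x = i} \<union> {q \<in> Q. c q x = j}"
      using x assms(5) coloured_inD[OF assms(2)] by blast
    then have "4 \<le> card {q \<in> Q. c q x = i} + card {q \<in> Q. c q x = j}"
      using card_mono[of "{q \<in> Q. c q x = i} \<union> {q \<in> Q. c q x = j}" Q] finQ assms(6)
        card_Un_le[of "{q \<in> Q. c q x = i}" "{q \<in> Q. c q x = j}"] by simp
    then show ?thesis using book_free_K4_nbhd[OF assms(3,5,6,7) x] by linarith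
  qed
  have "3 * card ?T \<le> (\<Sum>x\<in>?T. card {q \<in> Q. c q x = j})"
    using sum_bounded_below[of ?T 3 "\<lambda>x. card {q \<in> Q. c q x = j}"] ge by (simp add: mult.commute)
  also have "\<dots> = (\<Sum>q\<in>Q. card {x \<in> ?T. c q x = j})"
    using sum_multicount_gen[of ?T Q "\<lambda>x q. c q x = j" "\<lambda>q. card {x \<in> ?T. c q x = j}"] finQ assms(1) by simp
  also have "\<dots> \<le> (\<Sum>q\<in>Q. 10)"
  proof (rule sum_mono)
    fix q assume q: "q \<in> Q"
    have "card {x \<in> ?T. c q x = j} \<le> card {x \<in> S. x \<noteq> q \<and> c q x = j}"
      using assms(1) q by (intro card_mono) auto
    also have "\<dots> \<le> 10"
      using book_free_nbhd_small[OF assms(1) coloured_in_swap[OF assms(2)] assms(4,3)] q assms(5) by blast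
    finally show "card {x \<in> ?T. c q x = j} \<le> 10" .
  qed
  finally have "3 * card ?T \<le> 40" using assms(6) by simp
  moreover have "card ?T = card S - 4" using assms(5,6) finQ by (simp add: card_Diff_subset)
  ultimately show ?thesis by linarith
qed

text \<open>Nine neighbours exceed the bound 8 for triangle against book, so they contain an
  \<open>i\<close>-triangle, which \<open>v\<close> completes to a clique.\<close>

lemma book_free_nbhd_K4:
  assumes "finite S" "coloured_in {i, j} S" "book_free j S" "v \<in> S"
    "card {x \<in> S. x \<noteq> v \<and> c v x = i} \<ge> 9"
  obtains Q where "Q \<subseteq> S" "card Q = 4" "coloured_in {i} Q"
proof -
  let ?N = "{x \<in> S. x \<noteq> v \<and> c v x = i}"
  have N: "?N \<subseteq> S" by blast
  have "\<not> triangle_free i ?N"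
    using ramsey_triangle_book[of ?N i j] coloured_in_subset[OF assms(2) N]
      book_free_subset[OF assms(3) N] assms(1,5) by auto
  then obtain x y z where xyz: "x \<in> ?N" "y \<in> ?N" "z \<in> ?N" "x \<noteq> y" "x \<noteq> z" "y \<noteq> z"
      "c x y = i" "c x z = i" "c y z = i"
    by (rule not_triangle_freeE)
  show ?thesis
  proof (rule that[of "{v, x, y, z}"])
    show "coloured_in {i} {v, x, y, z}"
      using xyz c_sym unfolding coloured_in_def by auto
  qed (use xyz assms in auto)
qed

text \<open>In 18 vertices every vertex has degree at least 9 in some colour, which forces a
  monochromatic \<open>K_4\<close>; but a \<open>K_4\<close> limits the size to 17.\<close>

lemma ramsey_book_book:
  assumes "finite S" "coloured_in {i, j} S" "book_free i S" "book_free j S"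
  shows "card S \<le> 17"
proof (rule ccontr)
  assume big: "\<not> card S \<le> 17"
  then have "S \<noteq> {}" by auto
  then obtain v where v: "v \<in> S" by blast
  note sw = coloured_in_swap[OF assms(2)]
  have "card S \<ge> 8 + 8 + 2" using big by linarith
  then show False
  proof (rule two_colour_pigeonhole[OF assms(1,2) v])
    assume "8 + 1 \<le> card {x \<in> S. x \<noteq> v \<and> c v x = i}"
    then obtain Q where "Q \<subseteq> S" "card Q = 4" "coloured_in {i} Q"
      using book_free_nbhd_K4[OF assms(1,2,4) v] by auto
    then show False using book_free_K4_total_small[OF assms] big by blast
  next
    assume "8 + 1 \<le> card {x \<in> S. x \<noteq> v \<and> c v x = j}"
    then obtain Q where "Q \<subseteq> S" "card Q = 4" "coloured_in {j} Q"
      using book_free_nbhd_K4[OF assms(1) sw assms(3) v] by auto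
    then show False using book_free_K4_total_small[OF assms(1) sw assms(4,3)] big by blast
  qed
qed

end

section \<open>Gallai partitions\<close>

context sym_coloring
begin

section \<open>Connectivity of a single colour in a rainbow-free colouring\<close>

definition no_rainbow :: "'a set \<Rightarrow> bool" where
  "no_rainbow V \<longleftrightarrow> (\<forall>x\<in>V. \<forall>y\<in>V. \<forall>z\<in>V. distinct [x, y, z] \<longrightarrow>
     c x y = c y z \<or> c y z = c x z \<or> c x y = c x z)"

lemma no_rainbow_subset: "no_rainbow V \<Longrightarrow> W \<subseteq> V \<Longrightarrow> no_rainbow W"
  unfolding no_rainbow_def by blast

lemma no_rainbowD:
  "no_rainbow V \<Longrightarrow> x \<in> V \<Longrightarrow> y \<in> V \<Longrightarrow> z \<in> V \<Longrightarrow> x \<noteq> y \<Longrightarrow> y \<noteq> z \<Longrightarrow> x \<noteq> z \<Longrightarrow>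
   c x y = c y z \<or> c y z = c x z \<or> c x y = c x z"
  unfolding no_rainbow_def by simp

text \<open>Disconnectedness of the graph of colour \<open>i\<close> on \<open>V\<close>, encoded by
  a separating set.\<close>

definition has_cut :: "'k \<Rightarrow> 'a set \<Rightarrow> bool" where
  "has_cut i V \<longleftrightarrow> (\<exists>X. X \<noteq> {} \<and> X \<subset> V \<and> (\<forall>x\<in>X. \<forall>y\<in>V - X. c x y \<noteq> i))"

definition component :: "'k \<Rightarrow> 'a set \<Rightarrow> 'a \<Rightarrow> 'a set" where
  "component i V x = {y. (x, y) \<in> {(u, v). u \<in> V \<and> v \<in> V \<and> u \<noteq> v \<and> c u v = i}\<^sup>*}"

lemma component_refl: "x \<in> component i V x"
  unfolding component_def by simp

lemma component_subset: "x \<in> V \<Longrightarrow> component i V x \<subseteq> V"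
proof
  fix y assume "x \<in> V" "y \<in> component i V x"
  then have "(x, y) \<in> {(u, v). u \<in> V \<and> v \<in> V \<and> u \<noteq> v \<and> c u v = i}\<^sup>*" unfolding component_def by simp
  then show "y \<in> V" using \<open>x \<in> V\<close> by induction auto
qed

lemma component_eq:
  assumes "y \<in> component i V x"
  shows "component i V y = component i V x"
proof -
  let ?R = "{(u, v). u \<in> V \<and> v \<in> V \<and> u \<noteq> v \<and> c u v = i}"
  have "sym ?R" unfolding sym_def using c_sym by auto
  then have "sym (?R\<^sup>*)" by (rule sym_rtrancl)
  then have "(x, y) \<in> ?R\<^sup>*" "(y, x) \<in> ?R\<^sup>*" using assms unfolding component_def sym_def by auto
  then show ?thesis unfolding component_def by (auto intro: rtrancl_trans)
qed

lemma component_step: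
  "x \<in> V \<Longrightarrow> y \<in> component i V x \<Longrightarrow> z \<in> V \<Longrightarrow> y \<noteq> z \<Longrightarrow> c y z = i \<Longrightarrow> z \<in> component i V x"
  using subsetD[OF component_subset[of x V i], of y]
  unfolding component_def by (auto elim!: rtrancl_into_rtrancl)

lemma component_edge_out:
  "x \<in> V \<Longrightarrow> y \<in> component i V x \<Longrightarrow> z \<in> V \<Longrightarrow> z \<notin> component i V x \<Longrightarrow> c y z \<noteq> i"
  using component_step by blast

text \<open>Along an \<open>i\<close>-edge \<open>u w\<close> of the component, \<open>u z\<close>
  and \<open>w z\<close> both avoid colour \<open>i\<close>, so the triangle is rainbow unless they
  agree. An outside vertex thus sees a whole component in one colour.\<close>

lemma component_module:
  assumes "no_rainbow V" "x \<in> V" "y \<in> component i V x" "z \<in> V" "z \<notin> component i V x"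
  shows "c y z = c x z"
proof -
  have "(x, y) \<in> {(u, v). u \<in> V \<and> v \<in> V \<and> u \<noteq> v \<and> c u v = i}\<^sup>*"
    using assms(3) unfolding component_def by simp
  then show ?thesis
  proof induction
    case (step u w)
    then have u: "u \<in> component i V x" and w: "w \<in> component i V x" and uw: "u \<in> V" "w \<in> V" "u \<noteq> w" "c u w = i"
      unfolding component_def by (auto intro: rtrancl_into_rtrancl)
    have "c u z \<noteq> i" "c w z \<noteq> i" using component_edge_out assms u w by blast+
    moreover have "u \<noteq> z" "w \<noteq> z" using u w assms(5) by auto
    ultimately show ?case
      using no_rainbowD[OF assms(1) uw(1,2) assms(4)] uw step.IH by auto
  qed simp
qed

lemma component_has_cut:
  assumes "has_cut i V" "x \<in> V"
  obtains z where "z \<in> V" "z \<notin> component i V x"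
proof -
  obtain X where X: "X \<noteq> {}" "X \<subset> V" "\<forall>u\<in>X. \<forall>v\<in>V - X. c u v \<noteq> i"
    using assms(1) unfolding has_cut_def by blast
  have *: "component i V w \<subseteq> (if w \<in> X then X else V - X)" if "w \<in> V" for w
  proof
    fix y assume "y \<in> component i V w"
    then have "(w, y) \<in> {(u, v). u \<in> V \<and> v \<in> V \<and> u \<noteq> v \<and> c u v = i}\<^sup>*" unfolding component_def by simp
    then show "y \<in> (if w \<in> X then X else V - X)"
    proof induction
      case (step u v)
      then have "u \<in> V" "v \<in> V" "c u v = i" "c v u = i" using c_sym[of v u] by auto
      then show ?case using step.IH X(3) by (auto split: if_splits)
    qed (use that in auto)
  qed
  show ?thesis
  proof (cases "x \<in> X")
    case True
    then have "component i V x \<subseteq> X" using *[OF assms(2)] by simp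
    then show ?thesis using X(2) that by blast
  next
    case False
    then have "component i V x \<subseteq> V - X" using *[OF assms(2)] by simp
    then show ?thesis using X(1,2) that by blast
  qed
qed

text \<open>Since no colour disconnects \<open>V\<close>, the vertex \<open>v\<close> has edges in
  \<open>j\<close> and \<open>k\<close>, and an \<open>i\<close>-edge into every
  \<open>i\<close>-component of \<open>W\<close>. This makes a vertex \<open>a\<close> with
  \<open>c v a = l\<close>, \<open>l\<close> other than \<open>i\<close>, send colour
  \<open>l\<close> to all other components. Two such vertices, for \<open>j\<close> and for
  \<open>k\<close>, contradict each other.\<close>

lemma three_colours_cut_step:
  assumes "no_rainbow V" "v \<in> V" "W = V - {v}" "W \<noteq> {}" "has_cut i W"
    "\<not> has_cut i V" "\<not> has_cut j V" "\<not> has_cut k V" "i \<noteq> j" "i \<noteq> k" "j \<noteq> k"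
  shows False
proof -
  have W: "no_rainbow W" "W \<subseteq> V" "v \<notin> W" using no_rainbow_subset assms by auto
  have edge_v: "\<exists>x\<in>W. c v x = l" if "\<not> has_cut l V" for l
  proof (rule ccontr)
    assume "\<not> ?thesis"
    then have "has_cut l V" unfolding has_cut_def using assms(2-4) by (intro exI[of _ "{v}"]) auto
    then show False using that by simp
  qed
  obtain x y where xy: "x \<in> W" "c v x = j" "y \<in> W" "c v y = k"
    using edge_v assms by meson
  \<comment> \<open>An \<open>i\<close>-component of \<open>W\<close> without an
    \<open>i\<close>-edge to \<open>v\<close> would be cut off from the rest of \<open>V\<close> in
    colour \<open>i\<close>.\<close>
  have to_comp: "\<exists>b'\<in>component i W b. c v b' = i" if b: "b \<in> W" for b
  proof (rule ccontr)
    assume neg: "\<not> ?thesis"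
    have "has_cut i V"
      unfolding has_cut_def
    proof (intro exI[of _ "component i W b"] conjI ballI)
      show "component i W b \<noteq> {}" using component_refl by blast
      show "component i W b \<subset> V" using component_subset[OF b] assms(2) W by blast
    next
      fix u w assume u: "u \<in> component i W b" and w: "w \<in> V - component i W b"
      show "c u w \<noteq> i"
      proof (cases "w = v")
        case True
        then show ?thesis using neg u by (auto simp only: c_sym[of u v])
      next
        case False
        then show ?thesis using component_edge_out[OF b u] w assms(3) by blast
      qed
    qed
    then show False using assms(6) by simp
  qed
  \<comment> \<open>In the triangle \<open>v a b'\<close> the edges \<open>v a\<close> and
    \<open>v b'\<close> have colours \<open>l\<close> and \<open>i\<close>, and \<open>a b'\<close>
    avoids \<open>i\<close>, so \<open>a b'\<close> has colour \<open>l\<close>. As \<open>a\<close>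
    sees the component of \<open>b\<close> in one colour, so does \<open>a b\<close>.\<close>
  have col: "c a b = l" if a: "a \<in> W" "c v a = l" "l \<noteq> i" and b: "b \<in> W" "b \<notin> component i W a" for a b l
  proof -
    obtain b' where b': "b' \<in> component i W b" "c v b' = i" using to_comp[OF b(1)] by blast
    have b'W: "b' \<in> W" using component_subset[OF b(1)] b' by blast
    have nb': "b' \<notin> component i W a" using b(2) b'(1) component_eq component_refl by metis
    have na: "a \<notin> component i W b" using b(2) component_eq component_refl by metis
    have "c a b' \<noteq> i" using component_edge_out[OF a(1) component_refl b'W nb'] .
    moreover have "a \<noteq> b'" using nb' component_refl by metis
    moreover have "a \<in> V" "b' \<in> V" "v \<noteq> a" "v \<noteq> b'" using a(1) b'W W by blast+
    ultimately have "c a b' = l"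
      using no_rainbowD[OF assms(1,2), of a b'] a b'(2) by auto
    moreover have "c b' a = c b a" using component_module[OF W(1) b(1) b'(1) a(1) na] .
    ultimately show ?thesis using c_sym[of a b] c_sym[of a b'] by metis
  qed
  \<comment> \<open>In a common component, \<open>x\<close> and \<open>y\<close> would be seen from
    an outside vertex \<open>b\<close> in different colours. In different components, the edge
    \<open>x y\<close> itself would need both colours.\<close>
  show False
  proof (cases "y \<in> component i W x")
    case True
    obtain b where b: "b \<in> W" "b \<notin> component i W x" using component_has_cut[OF assms(5) xy(1)] .
    have "c x b = j" using col[OF xy(1,2) assms(9)[symmetric] b] .
    moreover have "b \<notin> component i W y" unfolding component_eq[OF True] by (rule b(2))
    then have "c y b = k" using col[OF xy(3,4) assms(10)[symmetric] b(1)] by blast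
    ultimately show False using component_module[OF W(1) xy(1) True b] assms(11) by simp
  next
    case False
    then have "x \<notin> component i W y" using component_eq component_refl by metis
    then have "c x y = j" "c y x = k"
      using col[OF xy(1,2) assms(9)[symmetric] xy(3) False] col[OF xy(3,4) assms(10)[symmetric] xy(1)]
      by blast+
    then show False using c_sym assms(11) by metis
  qed
qed

text \<open>Induction by deleting a vertex \<open>v\<close>: a colour that disconnects
  \<open>V - {v}\<close> takes the role of \<open>i\<close> in the step above. For two vertices the
  single edge has at most one of the three colours.\<close>

lemma three_colours_cut:
  assumes "finite V" "card V \<ge> 2" "no_rainbow V" "i \<noteq> j" "i \<noteq> k" "j \<noteq> k"
  shows "has_cut i V \<or> has_cut j V \<or> has_cut k V"
  using assms
proof (induction "card V" arbitrary: V rule: less_induct)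
  case less
  obtain v where v: "v \<in> V" using less.prems(2) by fastforce
  let ?W = "V - {v}"
  have cW: "card ?W = card V - 1" using v by simp
  show ?case
  proof (cases "card V = 2")
    case True
    then obtain x y where V: "V = {x, y}" "x \<noteq> y" by (auto simp: card_2_iff)
    have "has_cut l V" if "c x y \<noteq> l" for l
      unfolding has_cut_def using V that by (intro exI[of _ "{x}"]) auto
    then show ?thesis using less.prems by metis
  next
    case False
    have Wne: "?W \<noteq> {}" using cW less.prems(2) by force
    have "has_cut i ?W \<or> has_cut j ?W \<or> has_cut k ?W"
      using less.hyps[of ?W] less.prems False v no_rainbow_subset[OF less.prems(3), of ?W] cW by auto
    then show ?thesis
      using three_colours_cut_step[OF less.prems(3) v refl Wne] less.prems(4-6) by metis
  qed
qed

text \<open>The classes of the Gallai partition are the fibres of \<open>f\<close>.\<close>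

theorem gallai_partition:
  assumes "finite V" "card V \<ge> 2" "no_rainbow V" "k1 \<noteq> (k2::'k)"
  shows "\<exists>f :: 'a \<Rightarrow> 'a. \<exists>i j. i \<noteq> j \<and> (\<exists>x\<in>V. \<exists>y\<in>V. f x \<noteq> f y) \<and>
    (\<forall>x\<in>V. \<forall>y\<in>V. f x \<noteq> f y \<longrightarrow> c x y \<in> {i, j}) \<and>
    (\<forall>x\<in>V. \<forall>x'\<in>V. \<forall>y\<in>V. f x = f x' \<longrightarrow> f x \<noteq> f y \<longrightarrow> c x y = c x' y)"
  using assms(1-3)
proof (induction "card V" arbitrary: V rule: less_induct)
  case less
  define C where "C = {c x y |x y. x \<in> V \<and> y \<in> V \<and> x \<noteq> y}"
  show ?case
  proof (cases "\<exists>i j. i \<noteq> j \<and> C \<subseteq> {i, j}")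
    case True
    \<comment> \<open>With at most two colours present, the singletons already form a partition,
      given by \<open>f = id\<close>.\<close>
    then obtain i j where ij: "i \<noteq> j" "C \<subseteq> {i, j}" by blast
    have "\<exists>x\<in>V. \<exists>y\<in>V. x \<noteq> y"
      using less.prems(1,2) card_le_Suc0_iff_eq[of V] by fastforce
    have "\<forall>x\<in>V. \<forall>y\<in>V. x \<noteq> y \<longrightarrow> c x y \<in> {i, j}"
      using ij(2) unfolding C_def by blast
    with ij(1) \<open>\<exists>x\<in>V. \<exists>y\<in>V. x \<noteq> y\<close> show ?thesis
      by - (rule exI[of _ id], rule exI[of _ i], rule exI[of _ j], simp)
  next
    case False
    obtain i j k where ijk: "i \<in> C" "j \<in> C" "k \<in> C" "i \<noteq> j" "i \<noteq> k" "j \<noteq> k"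
    proof -
      obtain i where i: "i \<in> C" using False assms(4) by blast
      obtain l where l: "l \<noteq> i" using assms(4) by metis
      obtain j where j: "j \<in> C" "j \<noteq> i" using False l by blast
      obtain k where k: "k \<in> C" "k \<noteq> i" "k \<noteq> j" using False j by blast
      show ?thesis using that i j k by metis
    qed
    then obtain l where l: "l \<in> C" "has_cut l V"
      using three_colours_cut[OF less.prems ijk(4-6)] by blast
    \<comment> \<open>Each component of the disconnected colour \<open>l\<close> is contracted to a
      representative. Components are modules, so colours between different components survive the
      contraction.\<close>
    define g where "g x = (SOME y. y \<in> component l V x)" for x
    have g: "g x \<in> component l V x" for x unfolding g_def by (rule someI) (rule component_refl)
    have gV: "g x \<in> V" if "x \<in> V" for x using g component_subset[OF that] by blast
    have g_eq: "g x = g y \<longleftrightarrow> component l V x = component l V y" for x y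
      using g component_eq unfolding g_def by metis
    have g_mod: "c x y = c (g x) (g y)" if xy: "x \<in> V" "y \<in> V" "g x \<noteq> g y" for x y
    proof -
      have ny: "y \<notin> component l V x" "g y \<notin> component l V x" "x \<notin> component l V y"
        using xy(3) g_eq g component_eq by metis+
      have "c (g x) (g y) = c x (g y)"
        using component_module[OF less.prems(3) xy(1) g gV[OF xy(2)] ny(2)] .
      also have "\<dots> = c (g y) x" by (rule c_sym)
      also have "\<dots> = c y x" using component_module[OF less.prems(3) xy(2) g xy(1) ny(3)] .
      finally show ?thesis by (simp only: c_sym[of x y])
    qed
    let ?R = "g ` V"
    have R: "?R \<subseteq> V" using gV by blast
    obtain x y where xy: "x \<in> V" "y \<in> V" "x \<noteq> y" "c x y = l"
      using l(1) unfolding C_def by blast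
    \<comment> \<open>As \<open>l\<close> occurs in \<open>V\<close>, two vertices are merged and
      the induction hypothesis applies; as \<open>l\<close> is disconnected, at least two
      representatives remain.\<close>
    have "g x = g y" using component_step[OF xy(1) component_refl xy(2-4)] component_eq g_eq by metis
    then have "\<not> inj_on g V" using xy unfolding inj_on_def by blast
    then have lt: "card ?R < card V"
      using less.prems(1) card_image_le[of V g] eq_card_imp_inj_on[of V g] by linarith
    obtain z where z: "z \<in> V" "z \<notin> component l V x" using component_has_cut[OF l(2) xy(1)] .
    then have "g x \<noteq> g z" using g_eq component_refl by metis
    then have "card {g x, g z} = 2" by simp
    moreover have "card {g x, g z} \<le> card ?R" using less.prems(1) z xy by (intro card_mono) auto
    ultimately have "card ?R \<ge> 2" by simp
    then obtain f :: "'a \<Rightarrow> 'a" and i j where f: "i \<noteq> j" "\<exists>x\<in>?R. \<exists>y\<in>?R. f x \<noteq> f y"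
      "\<forall>x\<in>?R. \<forall>y\<in>?R. f x \<noteq> f y \<longrightarrow> c x y \<in> {i, j}"
      "\<forall>x\<in>?R. \<forall>x'\<in>?R. \<forall>y\<in>?R. f x = f x' \<longrightarrow> f x \<noteq> f y \<longrightarrow> c x y = c x' y"
      using less.hyps[OF lt _ _ no_rainbow_subset[OF less.prems(3) R]] less.prems(1) by blast
    show ?thesis
    proof (rule exI[of _ "f \<circ> g"], rule exI[of _ i], rule exI[of _ j], intro conjI ballI impI)
      show "\<exists>x\<in>V. \<exists>y\<in>V. (f \<circ> g) x \<noteq> (f \<circ> g) y" using f(2) by auto
    next
      fix x y assume "x \<in> V" "y \<in> V" "(f \<circ> g) x \<noteq> (f \<circ> g) y"
      then show "c x y \<in> {i, j}" using f(3) g_mod[of x y] by fastforce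
    next
      fix x x' y assume V: "x \<in> V" "x' \<in> V" "y \<in> V"
        and "(f \<circ> g) x = (f \<circ> g) x'" "(f \<circ> g) x \<noteq> (f \<circ> g) y"
      then have fg: "f (g x) = f (g x')" "f (g x) \<noteq> f (g y)" "g x \<noteq> g y" "g x' \<noteq> g y" by auto
      have "c x y = c (g x) (g y)" using g_mod[OF V(1,3) fg(3)] .
      also have "\<dots> = c (g x') (g y)" using f(4) V fg(1,2) by blast
      also have "\<dots> = c x' y" using g_mod[OF V(2,3) fg(4)] by simp
      finally show "c x y = c x' y" .
    qed (rule f(1))
  qed
qed

end

section \<open>Upper bound\<close>

fun book_factor :: "nat \<Rightarrow> nat" where
  "book_factor 0 = 1"
| "book_factor (Suc 0) = 4"
| "book_factor (Suc (Suc n)) = 17 * book_factor n"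

text \<open>The largest order of a Gallai colouring with \<open>b\<close> colours and no
  monochromatic triangle.\<close>

fun triangle_factor :: "nat \<Rightarrow> nat" where
  "triangle_factor 0 = 1"
| "triangle_factor (Suc 0) = 2"
| "triangle_factor (Suc (Suc n)) = 5 * triangle_factor n"

definition gallai_bound :: "nat \<Rightarrow> nat \<Rightarrow> nat" where
  "gallai_bound a b = book_factor a * triangle_factor b"

lemma book_factor_eq:
  "book_factor r = (if even r then 17 ^ (r div 2) else 4 * 17 ^ ((r - 1) div 2))"
proof (induction r rule: book_factor.induct)
  case (3 n)
  then show ?case by (cases n) auto
qed auto

lemma book_factor_pos: "book_factor n \<ge> 1"
  by (induction n rule: book_factor.induct) auto

lemma triangle_factor_pos: "triangle_factor n \<ge> 1"
  by (induction n rule: triangle_factor.induct) auto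

lemma book_factor_Suc_ge: "4 * book_factor n \<le> book_factor (Suc n)"
  by (induction n rule: book_factor.induct) auto

lemma book_factor_Suc_le: "4 * book_factor (Suc n) \<le> 17 * book_factor n"
  by (induction n rule: book_factor.induct) auto

text \<open>The ratio of consecutive values is 4 or 17/4; the larger ratio occurs only from the
  value 4 on, which supplies the slack in \<open>gallai_bound_two_books\<close>.\<close>

lemma book_factor_cases: "book_factor (Suc n) = 4 * book_factor n \<or> book_factor n \<ge> 4"
  by (induction n rule: book_factor.induct) auto

lemma triangle_factor_Suc_ge: "2 * triangle_factor n \<le> triangle_factor (Suc n)"
  by (induction n rule: triangle_factor.induct) auto

lemma triangle_factor_Suc_le: "2 * triangle_factor (Suc n) \<le> 5 * triangle_factor n"
  by (induction n rule: triangle_factor.induct) auto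

lemma gallai_bound_pos: "gallai_bound a b \<ge> 1"
  using mult_le_mono[OF book_factor_pos triangle_factor_pos] by (simp add: gallai_bound_def)

lemma gallai_bound_Suc_Suc:
  "gallai_bound (Suc (Suc a)) b = 17 * gallai_bound a b"
  "gallai_bound a (Suc (Suc b)) = 5 * gallai_bound a b"
  by (simp_all add: gallai_bound_def)

lemma gallai_bound_Suc_left:
  "4 * gallai_bound a b \<le> gallai_bound (Suc a) b"
  "4 * gallai_bound (Suc a) b \<le> 17 * gallai_bound a b"
  using mult_le_mono1[OF book_factor_Suc_ge[of a], of "triangle_factor b"]
    mult_le_mono1[OF book_factor_Suc_le[of a], of "triangle_factor b"]
  by (simp_all add: gallai_bound_def)

lemma gallai_bound_Suc_right:
  "2 * gallai_bound a b \<le> gallai_bound a (Suc b)"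
  "2 * gallai_bound a (Suc b) \<le> 5 * gallai_bound a b"
  using mult_le_mono2[OF triangle_factor_Suc_ge[of b], of "book_factor a"]
    mult_le_mono2[OF triangle_factor_Suc_le[of b], of "book_factor a"]
  by (simp_all add: gallai_bound_def mult.left_commute)

text \<open>With \<open>u = gallai_bound a b\<close> and \<open>t = gallai_bound a (Suc b)\<close>,
  integrality turns \<open>2 * t <= 5 * u\<close> and \<open>u >= 1\<close> into
  \<open>t + 1 <= 3 * u\<close>, and the right-hand side is at least \<open>4 * u\<close>.\<close>

lemma gallai_bound_join:
  "gallai_bound a (Suc b) + gallai_bound a b + 1 \<le> gallai_bound (Suc a) b"
  using gallai_bound_Suc_left[of a b] gallai_bound_Suc_right[of a b] gallai_bound_pos[of a b] by linarith

text \<open>In the same notation the right-hand side is \<open>17 * u\<close>. If the last summand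
  on the left is \<open>4 * t\<close>, then \<open>6 * t <= 15 * u\<close> suffices. Otherwise it is
  at most \<open>17/4 * t\<close>, the total is at most \<open>133/8 * u + 1\<close>, and
  \<open>u >= 4\<close> absorbs the constant.\<close>

lemma gallai_bound_two_books:
  "2 * gallai_bound a (Suc b) + gallai_bound a b + 1 + gallai_bound (Suc a) (Suc b)
     \<le> gallai_bound (Suc (Suc a)) b"
proof -
  have "gallai_bound (Suc a) (Suc b) = 4 * gallai_bound a (Suc b) \<or> gallai_bound a b \<ge> 4"
    using book_factor_cases[of a] mult_le_mono[of 4 "book_factor a" 1, OF _ triangle_factor_pos[of b]]
    by (auto simp: gallai_bound_def)
  then show ?thesis
    using gallai_bound_Suc_left[of a "Suc b"] gallai_bound_Suc_right[of a b] gallai_bound_pos[of a b]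
    by (auto simp: gallai_bound_Suc_Suc)
qed

context sym_coloring
begin

section \<open>Book colours, triangle colours and the induction hypothesis\<close>

definition good :: "'a set \<Rightarrow> 'k set \<Rightarrow> 'k set \<Rightarrow> bool" where
  "good V A B \<longleftrightarrow> finite V \<and> finite A \<and> finite B \<and> A \<inter> B = {} \<and> coloured_in (A \<union> B) V \<and>
     no_rainbow V \<and> (\<forall>i\<in>A. book_free i V) \<and> (\<forall>i\<in>B. triangle_free i V)"

text \<open>The induction hypothesis as a property of a set. All \<open>A\<close> and
  \<open>B\<close> are quantified because a colour may move from \<open>A\<close> to
  \<open>B\<close> or vanish on a subset.\<close>

definition bounded :: "'a set \<Rightarrow> bool" where
  "bounded X \<longleftrightarrow> (\<forall>W A B. W \<subseteq> X \<longrightarrow> good W A B \<longrightarrow> card W \<le> gallai_bound (card A) (card B))"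

lemma boundedD: "bounded X \<Longrightarrow> W \<subseteq> X \<Longrightarrow> good W A B \<Longrightarrow> card W \<le> gallai_bound (card A) (card B)"
  unfolding bounded_def by blast

lemma bounded_subset: "bounded X \<Longrightarrow> Y \<subseteq> X \<Longrightarrow> bounded Y"
  unfolding bounded_def by (meson subset_trans)

lemma goodD:
  assumes "good V A B"
  shows "finite V" "finite A" "finite B" "A \<inter> B = {}" "coloured_in (A \<union> B) V" "no_rainbow V"
    "i \<in> A \<Longrightarrow> book_free i V" "i \<in> B \<Longrightarrow> triangle_free i V"
  using assms unfolding good_def by auto

lemma good_subset: "good V A B \<Longrightarrow> W \<subseteq> V \<Longrightarrow> good W A B"
  unfolding good_def
  using finite_subset coloured_in_subset no_rainbow_subset book_free_subset triangle_free_subset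
  by meson

lemma good_edge_free:
  assumes "good V A B" "edge_free i V"
  shows "good V (A - {i}) (B - {i})"
proof -
  have "coloured_in (A - {i} \<union> (B - {i})) V"
    using goodD(5)[OF assms(1)] assms(2) unfolding coloured_in_def edge_free_def by blast
  then show ?thesis using assms(1) unfolding good_def by auto
qed

lemma good_edge_free_left:
  assumes "good V A B" "edge_free i V" "i \<in> A"
  shows "good V (A - {i}) B"
proof -
  have "B - {i} = B" using goodD(4)[OF assms(1)] assms(3) by blast
  then show ?thesis using good_edge_free[OF assms(1,2)] by simp
qed

lemma good_edge_free_right:
  assumes "good V A B" "edge_free i V" "i \<in> B"
  shows "good V A (B - {i})"
proof -
  have "A - {i} = A" using goodD(4)[OF assms(1)] assms(3) by blast
  then show ?thesis using good_edge_free[OF assms(1,2)] by simp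
qed

lemma good_triangle_free:
  assumes "good V A B" "triangle_free i V" "i \<in> A"
  shows "good V (A - {i}) (insert i B)"
proof -
  have "A - {i} \<union> insert i B = A \<union> B" using assms(3) by blast
  then show ?thesis using assms unfolding good_def by auto
qed

lemma card_bound_edge_free_left:
  assumes "bounded X" "good X A B" "edge_free i X" "i \<in> A" "card A = Suc a"
  shows "card X \<le> gallai_bound a (card B)"
  using boundedD[OF assms(1) order_refl good_edge_free_left[OF assms(2-4)]] assms(4,5)
    goodD(2)[OF assms(2)] by simp

lemma card_bound_edge_free_right:
  assumes "bounded X" "good X A B" "edge_free i X" "i \<in> B" "card B = Suc b"
  shows "card X \<le> gallai_bound (card A) b"
  using boundedD[OF assms(1) order_refl good_edge_free_right[OF assms(2-4)]] assms(4,5)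
    goodD(3)[OF assms(2)] by simp

lemma card_bound_triangle_free:
  assumes "bounded X" "good X A B" "triangle_free i X" "i \<in> A" "card A = Suc a"
  shows "card X \<le> gallai_bound a (Suc (card B))"
proof -
  have "i \<notin> B" using goodD(4)[OF assms(2)] assms(4) by blast
  then show ?thesis
    using boundedD[OF assms(1) order_refl good_triangle_free[OF assms(2-4)]] assms(4,5)
      goodD(2,3)[OF assms(2)] by simp
qed

text \<open>In a paw-free graph every triangle is a whole component, so deleting one vertex from each
  triangle destroys all triangles, and the deleted vertices are pairwise nonadjacent.\<close>

lemma paw_free_split:
  assumes "finite W" "paw_free i W"
  obtains W1 W2 where "W = W1 \<union> W2" "triangle_free i W1" "edge_free i W2"
proof -
  obtain h :: "'a \<Rightarrow> nat" where h: "inj_on h W"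
    using finite_imp_inj_to_nat_seg[OF assms(1)] by blast
  \<comment> \<open>The numbering \<open>h\<close> selects the smallest vertex of each
    triangle.\<close>
  define W2 where "W2 = {x \<in> W. \<exists>y\<in>W. \<exists>z\<in>W. x \<noteq> y \<and> x \<noteq> z \<and> y \<noteq> z \<and>
    c x y = i \<and> c x z = i \<and> c y z = i \<and> h x < h y \<and> h x < h z}"
  \<comment> \<open>Paw-freeness leaves \<open>x\<close> only its two triangle partners as
    neighbours, so \<open>x\<close> precedes all of them. Two adjacent vertices of \<open>W2\<close>
    would precede each other.\<close>
  have nbr: "h x < h w" if x: "x \<in> W2" and w: "w \<in> W" "w \<noteq> x" "c x w = i" for x w
  proof -
    obtain y z where yz: "y \<in> W" "z \<in> W" "x \<noteq> y" "x \<noteq> z" "y \<noteq> z"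
      "c x y = i" "c x z = i" "c y z = i" "h x < h y" "h x < h z" "x \<in> W"
      using x unfolding W2_def by blast
    have "w = y \<or> w = z"
    proof (rule ccontr)
      assume "\<not> ?thesis"
      then have "distinct [x, y, z, w]" using yz w(2) by auto
      from paw_freeD[OF assms(2) yz(11,1,2) w(1) this yz(6-8)] show False using w(3) by simp
    qed
    then show ?thesis using yz by auto
  qed
  have least: "x \<in> W2" if "x \<in> W" "y \<in> W" "z \<in> W" "x \<noteq> y" "x \<noteq> z" "y \<noteq> z"
    "c x y = i" "c x z = i" "c y z = i" "h x < h y" "h x < h z" for x y z
    using that unfolding W2_def by blast
  have "edge_free i W2"
    unfolding edge_free_def
  proof (intro ballI impI notI)
    fix x y assume xy: "x \<in> W2" "y \<in> W2" "x \<noteq> y" "c x y = i"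
    then have "x \<in> W" "y \<in> W" "c y x = i" using c_sym[of y x] unfolding W2_def by simp_all
    then show False using nbr[of x y] nbr[of y x] xy by simp
  qed
  moreover have "triangle_free i (W - W2)"
    unfolding triangle_free_def
  proof (intro ballI impI notI)
    fix x y z assume W: "x \<in> W - W2" "y \<in> W - W2" "z \<in> W - W2"
      and d: "x \<noteq> y \<and> x \<noteq> z \<and> y \<noteq> z" and "c x y = i \<and> c x z = i \<and> c y z = i"
    then have col: "c x y = i" "c y x = i" "c x z = i" "c z x = i" "c y z = i" "c z y = i"
      using c_sym by metis+
    have xyz: "x \<in> W" "y \<in> W" "z \<in> W" "x \<notin> W2" "y \<notin> W2" "z \<notin> W2" using W by simp_all
    have d': "x \<noteq> y" "x \<noteq> z" "y \<noteq> z" "y \<noteq> x" "z \<noteq> x" "z \<noteq> y" using d by auto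
    have "h x \<noteq> h y" "h x \<noteq> h z" "h y \<noteq> h z"
      using inj_on_eq_iff[OF h] xyz(1-3) d'(1-3) by simp_all
    then consider "h x < h y" "h x < h z" | "h y < h x" "h y < h z" | "h z < h x" "h z < h y"
      by linarith
    then show False
    proof cases
      case 1
      then show False using least[OF xyz(1,2,3) d'(1,2,3) col(1,3,5)] xyz(4) by blast
    next
      case 2
      then show False using least[OF xyz(2,1,3) d'(4,3,2) col(2,5,3)] xyz(5) by blast
    next
      case 3
      then show False using least[OF xyz(3,1,2) d'(5,6,1) col(4,6,1)] xyz(6) by blast
    qed
  qed
  moreover have "W = (W - W2) \<union> W2" unfolding W2_def by blast
  ultimately show ?thesis using that by blast
qed

text \<open>After deletion of one vertex from each \<open>i\<close>-triangle, \<open>i\<close>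
  becomes a triangle colour; on the deleted vertices \<open>i\<close> vanishes.\<close>

lemma card_bound_paw_free:
  assumes "bounded X" "good X A B" "paw_free i X" "i \<in> A" "card A = Suc a"
  shows "card X \<le> gallai_bound a (Suc (card B)) + gallai_bound a (card B)"
proof -
  obtain X1 X2 where X: "X = X1 \<union> X2" "triangle_free i X1" "edge_free i X2"
    by (rule paw_free_split[OF goodD(1)[OF assms(2)] assms(3)])
  then have sub: "X1 \<subseteq> X" "X2 \<subseteq> X" by auto
  have "card X1 \<le> gallai_bound a (Suc (card B))"
    by (rule card_bound_triangle_free[OF bounded_subset[OF assms(1) sub(1)]
          good_subset[OF assms(2) sub(1)] X(2) assms(4,5)])
  moreover have "card X2 \<le> gallai_bound a (card B)"
    by (rule card_bound_edge_free_left[OF bounded_subset[OF assms(1) sub(2)]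
          good_subset[OF assms(2) sub(2)] X(3) assms(4,5)])
  ultimately show ?thesis using card_Un_le[of X1 X2] unfolding X(1) by linarith
qed

text \<open>If \<open>Y\<close> is a single vertex, \<open>X\<close> is only paw-free, and the
  vertex accounts for the \<open>1\<close>. If \<open>Y\<close> has two vertices, \<open>X\<close>
  has no \<open>i\<close>-triangle and meets the first summand, while \<open>Y\<close> has no
  \<open>i\<close>-edge and meets the second.\<close>

lemma card_bound_joined_aux:
  assumes "joined i X Y" "Y \<noteq> {}" "good (X \<union> Y) A B" "i \<in> A" "card A = Suc a"
    "bounded X" "bounded Y" "edge_free i Y"
  shows "card (X \<union> Y) \<le> gallai_bound a (Suc (card B)) + gallai_bound a (card B) + 1"
proof -
  have gX: "good X A B" and gY: "good Y A B" using good_subset[OF assms(3)] by auto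
  note bf = goodD(7)[OF assms(3,4)]
  obtain y where y: "y \<in> Y" using assms(2) by blast
  show ?thesis
  proof (cases "Y = {y}")
    case True
    have "card X \<le> gallai_bound a (Suc (card B)) + gallai_bound a (card B)"
      by (rule card_bound_paw_free[OF assms(6) gX joined_imp_paw_free[OF assms(1) bf y] assms(4,5)])
    then show ?thesis using card_Un_le[of X Y] True by simp
  next
    case False
    then obtain y' where y': "y' \<in> Y" "y \<noteq> y'" using y by blast
    have "card X \<le> gallai_bound a (Suc (card B))"
      by (rule card_bound_triangle_free[OF assms(6) gX
            joined_imp_triangle_free[OF assms(1) bf y y'] assms(4,5)])
    moreover have "card Y \<le> gallai_bound a (card B)"
      by (rule card_bound_edge_free_left[OF assms(7) gY assms(8,4,5)])
    ultimately show ?thesis using card_Un_le[of X Y] by linarith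
  qed
qed

text \<open>If both sides contain \<open>i\<close>-edges, each has at most 2 vertices; a total of 4
  fits since the three summands are at least 2, 1 and 1.\<close>

lemma card_bound_joined:
  assumes "joined i X Y" "X \<noteq> {}" "Y \<noteq> {}" "good (X \<union> Y) A B" "i \<in> A" "card A = Suc a"
    "bounded X" "bounded Y"
  shows "card (X \<union> Y) \<le> gallai_bound a (Suc (card B)) + gallai_bound a (card B) + 1"
proof -
  note bf = goodD(7)[OF assms(4,5)]
  have j': "joined i Y X" using assms(1) joined_sym by blast
  have g': "good (Y \<union> X) A B" "book_free i (Y \<union> X)" using assms(4) bf by (simp_all add: Un_commute)
  consider "edge_free i Y" | "edge_free i X" | "\<not> edge_free i X" "\<not> edge_free i Y" by blast
  then show ?thesis
  proof cases
    case 1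
    then show ?thesis using card_bound_joined_aux[OF assms(1,3-8)] by simp
  next
    case 2
    then show ?thesis
      using card_bound_joined_aux[OF j' assms(2) g'(1) assms(5,6,8,7)] by (simp add: Un_commute)
  next
    case 3
    then have "card X \<le> 2" "card Y \<le> 2"
      using joined_imp_edge_free[OF assms(1) bf] joined_imp_edge_free[OF j' g'(2)] by linarith+
    then have "card (X \<union> Y) \<le> 4" using card_Un_le[of X Y] by linarith
    moreover have "gallai_bound a (card B) \<ge> 1" "gallai_bound a (Suc (card B)) \<ge> 2 * gallai_bound a (card B)"
      by (rule gallai_bound_pos) (rule gallai_bound_Suc_right)
    ultimately show ?thesis by linarith
  qed
qed

section \<open>Vertex sets split by a single colour\<close>

lemma triangle_free_joined_edge_free:
  assumes "triangle_free i (X \<union> Y)" "joined i X Y" "y \<in> Y"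
  shows "edge_free i X"
  unfolding edge_free_def
proof (intro ballI impI notI)
  fix u v assume "u \<in> X" "v \<in> X" "u \<noteq> v" "c u v = i"
  then show False
    using triangle_freeD[OF assms(1), of u v y] joinedD[OF assms(2) _ assms(3)] assms(3) by auto
qed

text \<open>A book colour between the sides is covered by \<open>card_bound_joined\<close>. A
  triangle colour vanishes on both sides, so twice the bound with one triangle colour less
  suffices.\<close>

lemma card_bound_single_colour_split:
  assumes "joined i X Y" "X \<noteq> {}" "Y \<noteq> {}" "good (X \<union> Y) A B" "bounded X" "bounded Y"
  shows "card (X \<union> Y) \<le> gallai_bound (card A) (card B)"
proof -
  obtain x y where xy: "x \<in> X" "y \<in> Y" using assms(2,3) by blast
  have "i \<in> A \<union> B"
    using coloured_inD[OF goodD(5)[OF assms(4)], of x y] joinedD[OF assms(1) xy] xy by auto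
  then consider "i \<in> A" | "i \<in> B" by blast
  then show ?thesis
  proof cases
    case 1
    then obtain a where a: "card A = Suc a"
      using goodD(2)[OF assms(4)] by (metis card_Suc_Diff1)
    show ?thesis
      using card_bound_joined[OF assms(1-4) 1 a assms(5,6)] gallai_bound_join[of a "card B"] a by simp
  next
    case 2
    then obtain b where b: "card B = Suc b"
      using goodD(3)[OF assms(4)] by (metis card_Suc_Diff1)
    note tf = goodD(8)[OF assms(4) 2]
    have j': "joined i Y X" using assms(1) joined_sym by blast
    have tf': "triangle_free i (Y \<union> X)" using tf by (simp add: Un_commute)
    have gX: "good X A B" and gY: "good Y A B" using good_subset[OF assms(4)] by auto
    have "card X \<le> gallai_bound (card A) b"
      by (rule card_bound_edge_free_right[OF assms(5) gX
            triangle_free_joined_edge_free[OF tf assms(1) xy(2)] 2 b])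
    moreover have "card Y \<le> gallai_bound (card A) b"
      by (rule card_bound_edge_free_right[OF assms(6) gY
            triangle_free_joined_edge_free[OF tf' j' xy(1)] 2 b])
    ultimately show ?thesis
      using card_Un_le[of X Y] gallai_bound_Suc_right(1)[of "card A" b] b by simp
  qed
qed

text \<open>Representatives taken from the classes of a Gallai partition with colours \<open>i\<close>, \<open>j\<close> span a
  two-coloured complete graph, whose size is bounded by the Ramsey number \<open>K + 1\<close>.\<close>

lemma card_bound_representatives:
  assumes "finite V" "K > 0"
    and col: "\<forall>x\<in>V. \<forall>y\<in>V. f x \<noteq> f y \<longrightarrow> c x y \<in> {i, j}"
    and rep: "\<And>p. p \<in> f ` V \<Longrightarrow>
      \<exists>T. T \<subseteq> {x \<in> V. f x = p} \<and> coloured_in {i, j} T \<and> K * card {x \<in> V. f x = p} \<le> card T * q"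
    and ram: "\<And>T. T \<subseteq> V \<Longrightarrow> coloured_in {i, j} T \<Longrightarrow> card T \<le> K"
  shows "card V \<le> q"
proof -
  have "\<forall>p\<in>f ` V. \<exists>T. T \<subseteq> {x \<in> V. f x = p} \<and> coloured_in {i, j} T \<and>
      K * card {x \<in> V. f x = p} \<le> card T * q"
    using rep by blast
  from bchoice[OF this] obtain T where T: "\<And>p. p \<in> f ` V \<Longrightarrow> T p \<subseteq> {x \<in> V. f x = p} \<and>
      coloured_in {i, j} (T p) \<and> K * card {x \<in> V. f x = p} \<le> card (T p) * q"
    by blast
  \<comment> \<open>Edges between classes have colour \<open>i\<close> or \<open>j\<close>, so the
    union of the chosen sets is still two-coloured and has at most \<open>K\<close> elements.
    Summing the weights over all classes gives
    \<open>K * card V <= card ?T * q <= K * q\<close>.\<close>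
  let ?T = "\<Union>p\<in>f ` V. T p"
  have "K * card V = (\<Sum>p\<in>f ` V. K * card {x \<in> V. f x = p})"
    using sum.image_gen[OF assms(1), of "\<lambda>_. 1::nat" f] by (simp add: sum_distrib_left)
  also have "\<dots> \<le> (\<Sum>p\<in>f ` V. card (T p) * q)"
    by (rule sum_mono) (use T in blast)
  also have "\<dots> = (\<Sum>p\<in>f ` V. card (T p)) * q"
    by (simp add: sum_distrib_right)
  also have "(\<Sum>p\<in>f ` V. card (T p)) = card ?T"
  proof (rule card_UN_disjoint[symmetric])
    show "\<forall>p\<in>f ` V. finite (T p)"
    proof
      fix p assume "p \<in> f ` V"
      then have "T p \<subseteq> V" using T by blast
      then show "finite (T p)" using assms(1) finite_subset by blast
    qed
    show "\<forall>p\<in>f ` V. \<forall>p'\<in>f ` V. p \<noteq> p' \<longrightarrow> T p \<inter> T p' = {}"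
    proof (intro ballI impI)
      fix p p' assume "p \<in> f ` V" "p' \<in> f ` V" "p \<noteq> p'"
      then have "T p \<subseteq> {x \<in> V. f x = p}" "T p' \<subseteq> {x \<in> V. f x = p'}" using T by simp_all
      then show "T p \<inter> T p' = {}" using \<open>p \<noteq> p'\<close> by blast
    qed
  qed (use assms(1) in simp)
  also have "card ?T \<le> K"
  proof (rule ram)
    show "?T \<subseteq> V" using T by blast
    show "coloured_in {i, j} ?T"
      unfolding coloured_in_def
    proof (intro ballI impI)
      fix x y assume "x \<in> ?T" "y \<in> ?T" and ne: "x \<noteq> y"
      then obtain p p' where p: "p \<in> f ` V" "x \<in> T p" "p' \<in> f ` V" "y \<in> T p'" by blast
      then have V: "x \<in> V" "y \<in> V" "f x = p" "f y = p'" using T by blast+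
      show "c x y \<in> {i, j}"
      proof (cases "p = p'")
        case True
        then show ?thesis using T[OF p(1)] p coloured_inD[of "{i, j}" "T p" x y] ne by blast
      next
        case False
        then show ?thesis using col V by blast
      qed
    qed
  qed
  finally have "K * card V \<le> K * q" by simp
  then show ?thesis using assms(2) by simp
qed

section \<open>A class containing an edge in a colour of the partition\<close>

lemma joined_small_or_edge_free:
  assumes "joined i P X" "book_free i (P \<union> X)" "\<not> edge_free i P"
  shows "card X \<le> 2 \<or> edge_free i X"
proof -
  have "joined i X P" "book_free i (X \<union> P)" using assms joined_sym by (simp_all add: Un_commute)
  then show ?thesis using joined_imp_edge_free[of i X P] assms(3) by linarith
qed

lemma joined_not_triangle_free:
  assumes "joined i P X" "book_free i (P \<union> X)" "\<not> triangle_free i P" "finite X"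
  shows "card X \<le> 1"
  using joined_imp_triangle_free[OF assms(1,2)] assms(3,4) card_le_Suc0_iff_eq[of X]
  by (metis One_nat_def)

text \<open>Split first for \<open>i\<close>, then each part for \<open>j\<close>. Let
  \<open>u = gallai_bound a (card B)\<close> and \<open>t = gallai_bound a (Suc (card B))\<close>.
  The part where \<open>i\<close> is a triangle colour contributes \<open>5 * u + t\<close>, the
  part without \<open>i\<close> contributes \<open>t + u\<close>.\<close>

lemma card_bound_paw_free_two:
  assumes "bounded X" "good X A B" "paw_free i X" "paw_free j X" "i \<in> A" "j \<in> A" "i \<noteq> j"
    "card A = Suc (Suc a)"
  shows "card X \<le> 6 * gallai_bound a (card B) + 2 * gallai_bound a (Suc (card B))"
proof -
  obtain X1 X2 where X: "X = X1 \<union> X2" "triangle_free i X1" "edge_free i X2"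
    by (rule paw_free_split[OF goodD(1)[OF assms(2)] assms(3)])
  then have sub: "X1 \<subseteq> X" "X2 \<subseteq> X" by auto
  have A: "j \<in> A - {i}" "card (A - {i}) = Suc a"
    using assms(5-8) goodD(2)[OF assms(2)] by simp_all
  have B: "card (insert i B) = Suc (card B)"
    using goodD(3,4)[OF assms(2)] assms(5) by (subst card_insert_disjoint) auto
  have "card X1 \<le> gallai_bound a (Suc (card (insert i B))) + gallai_bound a (card (insert i B))"
    by (rule card_bound_paw_free[OF bounded_subset[OF assms(1) sub(1)]
          good_triangle_free[OF good_subset[OF assms(2) sub(1)] X(2) assms(5)]
          paw_free_subset[OF assms(4) sub(1)] A])
  moreover have "card X2 \<le> gallai_bound a (Suc (card B)) + gallai_bound a (card B)"
    by (rule card_bound_paw_free[OF bounded_subset[OF assms(1) sub(2)]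
          good_edge_free_left[OF good_subset[OF assms(2) sub(2)] X(3) assms(5)]
          paw_free_subset[OF assms(4) sub(2)] A])
  ultimately show ?thesis
    using card_Un_le[of X1 X2] unfolding X(1) B gallai_bound_Suc_Suc by linarith
qed

text \<open>If some class \<open>P\<close> of the Gallai partition has an edge in colour \<open>i\<close>, then its neighbourhoods
  \<open>X\<close> and \<open>Y\<close> in the two colours of the partition are so restricted that counting classes is
  unnecessary.\<close>

lemma card_bound_two_books:
  assumes "good (P \<union> X \<union> Y) A B" "i \<in> A" "j \<in> A" "i \<noteq> j" "card A = Suc (Suc a)"
    "joined i P X" "joined j P Y" "X \<noteq> {}" "Y \<noteq> {}" "bounded P" "bounded X" "bounded Y"
    "\<not> edge_free i P"
    and X_edge_free: "edge_free i X \<Longrightarrow>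
      card X \<le> gallai_bound a (Suc (card B)) + gallai_bound a (card B) + 1"
  shows "card P + card X + card Y \<le> gallai_bound (Suc (Suc a)) (card B)"
proof -
  define s t u q where "s = gallai_bound (Suc a) (card B)" and "t = gallai_bound a (Suc (card B))"
    and "u = gallai_bound a (card B)" and "q = gallai_bound (Suc a) (Suc (card B))"
  have ineqs: "u \<ge> 1" "2 * u \<le> t" "2 * t \<le> 5 * u" "4 * u \<le> s" "4 * s \<le> 17 * u"
    "2 * t + u + 1 + q \<le> 17 * u"
    using gallai_bound_pos[of a "card B"] gallai_bound_Suc_right[of a "card B"]
      gallai_bound_Suc_left[of a "card B"] gallai_bound_two_books[of a "card B"]
    unfolding s_def t_def u_def q_def gallai_bound_Suc_Suc by simp_all
  have gP: "good P A B" and gX: "good X A B" and gY: "good Y A B"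
    by (rule good_subset[OF assms(1)]; blast)+
  have bi: "book_free i (P \<union> X)" and bj: "book_free j (P \<union> Y)"
    using book_free_subset[OF goodD(7)[OF assms(1,2)], of "P \<union> X"]
      book_free_subset[OF goodD(7)[OF assms(1,3)], of "P \<union> Y"] by auto
  have bj': "book_free j (Y \<union> P)" "joined j Y P"
    using bj assms(7) joined_sym by (simp_all add: Un_commute)
  have pi: "paw_free i P" using joined_imp_paw_free[OF assms(6) bi] assms(8) by blast
  have pj: "paw_free j P" using joined_imp_paw_free[OF assms(7) bj] assms(9) by blast
  have X: "card X \<le> 2 \<or> edge_free i X"
    by (rule joined_small_or_edge_free[OF assms(6) bi assms(13)])
  have X1: "card X \<le> t + u + 1"
    using X X_edge_free ineqs unfolding t_def u_def by linarith
  have X2: "card X \<le> s"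
    using X card_bound_edge_free_left[OF assms(11) gX _ assms(2,5)] ineqs unfolding s_def by linarith
  have X3: "card X \<le> 1" if "\<not> triangle_free i P"
    by (rule joined_not_triangle_free[OF assms(6) bi that goodD(1)[OF gX]])
  have A: "i \<in> A - {j}" "card (A - {j}) = Suc a"
    using assms(2-5) goodD(2)[OF gP] by simp_all
  show ?thesis
  proof (cases "edge_free j P")
    case True
    \<comment> \<open>Without \<open>j\<close> in \<open>P\<close>: the ends of an
      \<open>i\<close>-edge of \<open>P\<close> exclude \<open>j\<close>-triangles in
      \<open>Y\<close>, so \<open>card Y <= q\<close>. An \<open>i\<close>-triangle in
      \<open>P\<close> adds \<open>u\<close> to the bound for \<open>P\<close> but reduces
      \<open>X\<close> to one vertex, so \<open>P\<close> and \<open>X\<close> together stay within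
      \<open>2 * t + u + 1\<close>.\<close>
    have gP': "good P (A - {j}) B" by (rule good_edge_free_left[OF gP True assms(3)])
    obtain p p' where "p \<in> P" "p' \<in> P" "p \<noteq> p'" using assms(13) by (rule not_edge_freeE)
    then have "triangle_free j Y" by (rule joined_imp_triangle_free[OF bj'(2,1)])
    then have "card Y \<le> q"
      using card_bound_triangle_free[OF assms(12) gY _ assms(3,5)] unfolding q_def by blast
    moreover have "card P + card X \<le> 2 * t + u + 1"
    proof (cases "triangle_free i P")
      case True
      then have "card P \<le> t"
        using card_bound_triangle_free[OF assms(10) gP' _ A] unfolding t_def by blast
      then show ?thesis using X1 by linarith
    next
      case False
      have "card P \<le> t + u"
        using card_bound_paw_free[OF assms(10) gP' pi A] unfolding t_def u_def .
      then show ?thesis using X3[OF False] by linarith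
    qed
    ultimately show ?thesis using ineqs(6) unfolding gallai_bound_Suc_Suc u_def by linarith
  next
    case False
    \<comment> \<open>With edges of both colours in \<open>P\<close>, each of \<open>X\<close> and
      \<open>Y\<close> has at most \<open>s <= 17/4 * u\<close> vertices. If \<open>P\<close> has no
      triangle in either colour, both become triangle colours and
      \<open>card P <= 5 * u\<close>.\<close>
    have Y2: "card Y \<le> s"
      using joined_small_or_edge_free[OF assms(7) bj False]
        card_bound_edge_free_left[OF assms(12) gY _ assms(3,5)] ineqs unfolding s_def by linarith
    have Y3: "card Y \<le> 1" if "\<not> triangle_free j P"
      by (rule joined_not_triangle_free[OF assms(7) bj that goodD(1)[OF gY]])
    show ?thesis
    proof (cases "triangle_free i P \<and> triangle_free j P")
      case True
      have "i \<notin> B" "j \<notin> B" using goodD(4)[OF gP] assms(2,3) by blast+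
      have "good P (A - {j}) (insert j B)" using good_triangle_free[OF gP _ assms(3)] True by blast
      then have "card P \<le> gallai_bound a (Suc (card (insert j B)))"
        using card_bound_triangle_free[OF assms(10) _ _ A] True by blast
      then have "card P \<le> 5 * u"
        using \<open>j \<notin> B\<close> goodD(3)[OF gP] by (simp add: gallai_bound_Suc_Suc u_def)
      then have "card P + card X + card Y \<le> 17 * u" using X2 Y2 ineqs by linarith
      then show ?thesis unfolding gallai_bound_Suc_Suc u_def .
    next
      case False
      \<comment> \<open>A triangle of \<open>P\<close> in one of the colours reduces
        \<open>X\<close> or \<open>Y\<close> to one vertex, so the total is at most
        \<open>11 * u + 1 + 17/4 * u\<close>.\<close>
      have "card P \<le> 6 * u + 2 * t"
        using card_bound_paw_free_two[OF assms(10) gP pi pj assms(2-5)] unfolding t_def u_def .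
      moreover have "card X + card Y \<le> 1 + s"
        using False X2 X3 Y2 Y3 by force
      ultimately have "card P + card X + card Y \<le> 17 * u" using ineqs by linarith
      then show ?thesis unfolding gallai_bound_Suc_Suc u_def .
    qed
  qed
qed

end

context sym_coloring
begin

section \<open>Counting the classes of a Gallai partition\<close>

definition gallai_classes :: "('a \<Rightarrow> 'b) \<Rightarrow> 'a set \<Rightarrow> 'k \<Rightarrow> 'k \<Rightarrow> bool" where
  "gallai_classes f V i j \<longleftrightarrow> i \<noteq> j \<and>
     (\<forall>x\<in>V. \<forall>y\<in>V. f x \<noteq> f y \<longrightarrow> c x y \<in> {i, j}) \<and>
     (\<forall>x\<in>V. \<forall>x'\<in>V. \<forall>y\<in>V. f x = f x' \<longrightarrow> f x \<noteq> f y \<longrightarrow> c x y = c x' y)"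

definition fibre :: "('a \<Rightarrow> 'b) \<Rightarrow> 'a set \<Rightarrow> 'a \<Rightarrow> 'a set" where
  "fibre f V x = {y \<in> V. f y = f x}"

definition nbrs :: "('a \<Rightarrow> 'b) \<Rightarrow> 'a set \<Rightarrow> 'k \<Rightarrow> 'a \<Rightarrow> 'a set" where
  "nbrs f V k x = {y \<in> V. f y \<noteq> f x \<and> c x y = k}"

lemma gallai_classes_sym: "gallai_classes f V i j \<Longrightarrow> gallai_classes f V j i"
  unfolding gallai_classes_def by blast

lemma fibre_refl: "x \<in> V \<Longrightarrow> x \<in> fibre f V x"
  unfolding fibre_def by simp

lemma fibre_subset: "fibre f V x \<subseteq> V"
  unfolding fibre_def by blast

lemma nbrs_subset: "nbrs f V k x \<subseteq> V"
  unfolding nbrs_def by blast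

lemma joined_fibre_nbrs:
  assumes "gallai_classes f V i j" "x \<in> V"
  shows "joined k (fibre f V x) (nbrs f V k x)"
  unfolding joined_def
proof (intro conjI ballI)
  show "fibre f V x \<inter> nbrs f V k x = {}" unfolding fibre_def nbrs_def by blast
  fix y z assume "y \<in> fibre f V x" "z \<in> nbrs f V k x"
  then have yz: "y \<in> V" "z \<in> V" "f x = f y" "f x \<noteq> f z" "c x z = k"
    unfolding fibre_def nbrs_def by auto
  then have "c x z = c y z" using assms unfolding gallai_classes_def by blast
  then show "c y z = k" using yz by simp
qed

lemma fibre_nbrs_cover:
  assumes "gallai_classes f V i j" "x \<in> V"
  shows "V = fibre f V x \<union> nbrs f V i x \<union> nbrs f V j x"
proof
  show "V \<subseteq> fibre f V x \<union> nbrs f V i x \<union> nbrs f V j x"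
  proof
    fix y assume y: "y \<in> V"
    show "y \<in> fibre f V x \<union> nbrs f V i x \<union> nbrs f V j x"
    proof (cases "f x = f y")
      case True
      then show ?thesis using y unfolding fibre_def by simp
    next
      case False
      then have "c x y \<in> {i, j}" using assms y unfolding gallai_classes_def by blast
      then show ?thesis using False y unfolding nbrs_def by auto
    qed
  qed
qed (auto simp: fibre_def nbrs_def)

lemma fibre_proper: "nbrs f V k x \<noteq> {} \<Longrightarrow> fibre f V x \<subset> V"
  unfolding fibre_def nbrs_def by blast

lemma nbrs_proper: "x \<in> V \<Longrightarrow> nbrs f V k x \<subset> V"
  unfolding nbrs_def by blast

lemma nbrs_colour:
  assumes "good V A B" "x \<in> V" "nbrs f V k x \<noteq> {}"
  shows "k \<in> A \<union> B"
proof -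
  obtain y where "y \<in> V" "f y \<noteq> f x" "c x y = k" using assms(3) unfolding nbrs_def by blast
  then show ?thesis using coloured_inD[OF goodD(5)[OF assms(1)] assms(2), of y] by auto
qed

lemma fibre_edge_free:
  assumes "gallai_classes f V i j" "good V A B" "x \<in> V" "k \<in> B" "nbrs f V k x \<noteq> {}"
  shows "edge_free k (fibre f V x)"
proof -
  obtain y where y: "y \<in> nbrs f V k x" using assms(5) by blast
  have "fibre f V x \<union> nbrs f V k x \<subseteq> V" using fibre_subset nbrs_subset by blast
  then show ?thesis
    using triangle_free_joined_edge_free[OF _ joined_fibre_nbrs[OF assms(1,3)] y]
      triangle_free_subset[OF goodD(8)[OF assms(2,4)]] by blast
qed

lemma fibre_paw_free:
  assumes "gallai_classes f V i j" "good V A B" "x \<in> V" "k \<in> A" "nbrs f V k x \<noteq> {}"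
  shows "paw_free k (fibre f V x)"
proof -
  obtain y where y: "y \<in> nbrs f V k x" using assms(5) by blast
  have "fibre f V x \<union> nbrs f V k x \<subseteq> V" using fibre_subset nbrs_subset by blast
  then show ?thesis
    using joined_imp_paw_free[OF joined_fibre_nbrs[OF assms(1,3)] _ y]
      book_free_subset[OF goodD(7)[OF assms(2,4)]] by blast
qed

lemma coloured_in_singleton: "coloured_in K {x}"
  unfolding coloured_in_def by simp

text \<open>Both colours vanish inside every class, which leaves a fifth of the bound, and
  \<open>R(3,3) <= 6\<close> allows at most 5 classes.\<close>

lemma card_bound_classes_triangle_triangle:
  assumes g: "gallai_classes f V i j" and good: "good V A B"
    and ne: "\<And>x. x \<in> V \<Longrightarrow> nbrs f V i x \<noteq> {} \<and> nbrs f V j x \<noteq> {}"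
    and bd: "\<And>X. X \<subset> V \<Longrightarrow> bounded X" and ij: "i \<in> B" "j \<in> B"
  shows "card V \<le> gallai_bound (card A) (card B)"
proof (rule card_bound_representatives[of V 5 f i j])
  have "i \<noteq> j" and col: "\<forall>x\<in>V. \<forall>y\<in>V. f x \<noteq> f y \<longrightarrow> c x y \<in> {i, j}"
    using g unfolding gallai_classes_def by blast+
  then show "\<forall>x\<in>V. \<forall>y\<in>V. f x \<noteq> f y \<longrightarrow> c x y \<in> {i, j}" by blast
  show "finite V" by (rule goodD(1)[OF good])
  show "card T \<le> 5" if "T \<subseteq> V" "coloured_in {i, j} T" for T
    using ramsey_triangle_triangle[OF _ that(2)] finite_subset[OF that(1) goodD(1)[OF good]]
      triangle_free_subset[OF goodD(8)[OF good ij(1)] that(1)]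
      triangle_free_subset[OF goodD(8)[OF good ij(2)] that(1)] by blast
  fix p assume "p \<in> f ` V"
  then obtain x where x: "x \<in> V" "p = f x" by blast
  have sub: "fibre f V x \<subset> V" using fibre_proper ne[OF x(1)] by blast
  have B: "card (B - {i}) = Suc (card (B - {i} - {j}))" "card B = Suc (Suc (card (B - {i} - {j})))"
    using ij \<open>i \<noteq> j\<close> goodD(3)[OF good] card_Suc_Diff1[of B i] card_Suc_Diff1[of "B - {i}" j] by simp_all
  have "good (fibre f V x) A (B - {i})"
    by (rule good_edge_free_right[OF good_subset[OF good fibre_subset] _ ij(1)])
      (use fibre_edge_free[OF g good x(1) ij(1)] ne[OF x(1)] in blast)
  then have "card (fibre f V x) \<le> gallai_bound (card A) (card (B - {i} - {j}))"
    using card_bound_edge_free_right[OF bd[OF sub] _ _ _ B(1), of A j]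
      fibre_edge_free[OF g good x(1) ij(2)] ne[OF x(1)] ij(2) \<open>i \<noteq> j\<close> by blast
  then have "5 * card (fibre f V x) \<le> gallai_bound (card A) (card B)"
    unfolding B(2) gallai_bound_Suc_Suc by simp
  then have "5 * card {y \<in> V. f y = p} \<le> card {x} * gallai_bound (card A) (card B)"
    unfolding fibre_def x(2) by simp
  moreover have "{x} \<subseteq> {y \<in> V. f y = p}" using x by simp
  ultimately show "\<exists>T\<subseteq>{y \<in> V. f y = p}. coloured_in {i, j} T \<and>
      5 * card {y \<in> V. f y = p} \<le> card T * gallai_bound (card A) (card B)"
    using coloured_in_singleton by blast
qed simp

text \<open>Inside a class \<open>j\<close> vanishes and \<open>i\<close> is paw-free. A class
  supplies 3, 2 or 1 representatives according to whether it contains an \<open>i\<close>-triangle,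
  only \<open>i\<close>-edges, or neither, and its size is at most that many eighths of the bound.
  All representatives together are two-coloured, so there are at most 8.\<close>

lemma card_bound_classes_book_triangle:
  assumes g: "gallai_classes f V i j" and good: "good V A B"
    and ne: "\<And>x. x \<in> V \<Longrightarrow> nbrs f V i x \<noteq> {} \<and> nbrs f V j x \<noteq> {}"
    and bd: "\<And>X. X \<subset> V \<Longrightarrow> bounded X" and ij: "i \<in> A" "j \<in> B"
  shows "card V \<le> gallai_bound (card A) (card B)"
proof (rule card_bound_representatives[of V 8 f i j])
  have "i \<noteq> j" and col: "\<forall>x\<in>V. \<forall>y\<in>V. f x \<noteq> f y \<longrightarrow> c x y \<in> {i, j}"
    using g unfolding gallai_classes_def by blast+
  then show "\<forall>x\<in>V. \<forall>y\<in>V. f x \<noteq> f y \<longrightarrow> c x y \<in> {i, j}" by blast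
  show "finite V" by (rule goodD(1)[OF good])
  show "card T \<le> 8" if "T \<subseteq> V" "coloured_in {i, j} T" for T
    using ramsey_triangle_book[OF _ coloured_in_swap[OF that(2)]]
      finite_subset[OF that(1) goodD(1)[OF good]]
      triangle_free_subset[OF goodD(8)[OF good ij(2)] that(1)]
      book_free_subset[OF goodD(7)[OF good ij(1)] that(1)] by blast
  fix p assume "p \<in> f ` V"
  then obtain x where x: "x \<in> V" "p = f x" by blast
  let ?F = "{y \<in> V. f y = p}"
  have F: "?F = fibre f V x" unfolding fibre_def x(2) by simp
  have sub: "?F \<subset> V" using fibre_proper ne[OF x(1)] unfolding F by blast
  obtain a b where a: "card A = Suc a" and b: "card B = Suc b"
    using ij goodD(2,3)[OF good] by (metis card_Suc_Diff1)
  have b': "card (B - {j}) = b" using b ij(2) goodD(3)[OF good] by simp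
  have gF: "good ?F A (B - {j})"
    unfolding F
    by (rule good_edge_free_right[OF good_subset[OF good fibre_subset] _ ij(2)])
      (use fibre_edge_free[OF g good x(1) ij(2)] ne[OF x(1)] in blast)
  have paw: "paw_free i ?F"
    unfolding F using fibre_paw_free[OF g good x(1) ij(1)] ne[OF x(1)] by blast
  \<comment> \<open>These give the shares 1/4 + 1/8 = 3/8 for a paw-free class, 1/4 = 2/8 for a
    triangle-free one and 1/8 for one without \<open>i\<close>-edges.\<close>
  have ineq: "4 * gallai_bound a (card B) \<le> gallai_bound (card A) (card B)"
    "2 * gallai_bound a b \<le> gallai_bound a (card B)"
    unfolding a b by (rule gallai_bound_Suc_left gallai_bound_Suc_right)+
  show "\<exists>T\<subseteq>?F. coloured_in {i, j} T \<and> 8 * card ?F \<le> card T * gallai_bound (card A) (card B)"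
  proof (cases "triangle_free i ?F")
    case False
    then obtain u v w where uvw: "u \<in> ?F" "v \<in> ?F" "w \<in> ?F" "u \<noteq> v" "u \<noteq> w" "v \<noteq> w"
      "c u v = i" "c u w = i" "c v w = i"
      by (rule not_triangle_freeE)
    then have "{u, v, w} \<subseteq> ?F" "card {u, v, w} = 3" by simp_all
    moreover have "c v u = i" "c w u = i" "c w v = i" using uvw(7-9) c_sym by metis+
    with uvw have "coloured_in {i, j} {u, v, w}" unfolding coloured_in_def by simp
    moreover have "8 * card ?F \<le> 3 * gallai_bound (card A) (card B)"
      using card_bound_paw_free[OF bd[OF sub] gF paw ij(1) a] ineq unfolding b' b by linarith
    ultimately show ?thesis by (intro exI[of _ "{u, v, w}"] conjI) simp_all
  next
    case True
    show ?thesis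
    proof (cases "edge_free i ?F")
      case False
      then obtain u v where uv: "u \<in> ?F" "v \<in> ?F" "u \<noteq> v" "c u v = i" by (rule not_edge_freeE)
      then have "{u, v} \<subseteq> ?F" "card {u, v} = 2" by simp_all
      moreover have "c v u = i" using uv(4) c_sym by metis
      with uv have "coloured_in {i, j} {u, v}" unfolding coloured_in_def by simp
      moreover have "8 * card ?F \<le> 2 * gallai_bound (card A) (card B)"
        using card_bound_triangle_free[OF bd[OF sub] gF True ij(1) a] ineq unfolding b' b by linarith
      ultimately show ?thesis by (intro exI[of _ "{u, v}"] conjI) simp_all
    next
      case True
      have "8 * card ?F \<le> card {x} * gallai_bound (card A) (card B)"
        using card_bound_edge_free_left[OF bd[OF sub] gF True ij(1) a] ineq unfolding b' b by simp
      moreover have "{x} \<subseteq> ?F" using x by simp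
      ultimately show ?thesis using coloured_in_singleton by blast
    qed
  qed
qed simp

text \<open>The class of \<open>x\<close> and its two neighbourhoods cover \<open>V\<close>, so
  \<open>card_bound_two_books\<close> applies once the \<open>i\<close>-neighbourhood is bounded in
  the case that it has no \<open>i\<close>-edge. It is a union of classes, then pairwise joined in
  \<open>j\<close>: either a single class, which is paw-free in \<open>j\<close>, or a join in
  colour \<open>j\<close> of one class and the rest.\<close>

lemma card_bound_classes_edge:
  assumes g: "gallai_classes f V i j" and good: "good V A B"
    and ne: "\<And>x. x \<in> V \<Longrightarrow> nbrs f V i x \<noteq> {} \<and> nbrs f V j x \<noteq> {}"
    and bd: "\<And>X. X \<subset> V \<Longrightarrow> bounded X" and ij: "i \<in> A" "j \<in> A"
    and x: "x \<in> V" "\<not> edge_free i (fibre f V x)"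
  shows "card V \<le> gallai_bound (card A) (card B)"
proof -
  have "i \<noteq> j" using g unfolding gallai_classes_def by blast
  let ?P = "fibre f V x" and ?X = "nbrs f V i x" and ?Y = "nbrs f V j x"
  have cover: "V = ?P \<union> ?X \<union> ?Y" by (rule fibre_nbrs_cover[OF g x(1)])
  have sub: "?P \<subset> V" "?X \<subset> V" "?Y \<subset> V"
    using fibre_proper[of f V i x] ne[OF x(1)] nbrs_proper[OF x(1)] by blast+
  have "card A = Suc (Suc (card (A - {i} - {j})))"
    using ij \<open>i \<noteq> j\<close> goodD(2)[OF good] card_Suc_Diff1[of A i] card_Suc_Diff1[of "A - {i}" j] by simp
  then obtain a where a: "card A = Suc (Suc a)" by blast
  have X: "card ?X \<le> gallai_bound a (Suc (card B)) + gallai_bound a (card B) + 1"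
    if ef: "edge_free i ?X"
  proof -
    have gX: "good ?X (A - {i}) B"
      by (rule good_edge_free_left[OF good_subset[OF good nbrs_subset] ef ij(1)])
    have A: "j \<in> A - {i}" "card (A - {i}) = Suc a"
      using ij a \<open>i \<noteq> j\<close> goodD(2)[OF good] by simp_all
    obtain w where w: "w \<in> ?X" using ne[OF x(1)] by blast
    then have wV: "w \<in> V" using nbrs_subset by blast
    let ?Q = "fibre f V w"
    have QX: "?Q \<subseteq> ?X"
    proof
      fix z assume "z \<in> ?Q"
      then have z: "z \<in> V" "f w = f z" unfolding fibre_def by auto
      have w': "f w \<noteq> f x" "c x w = i" using w unfolding nbrs_def by auto
      then have "c w x = c z x" using g wV z x(1) unfolding gallai_classes_def by blast
      then have "c x z = i" using w'(2) c_sym by metis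
      then show "z \<in> ?X" using z w' unfolding nbrs_def by simp
    qed
    show ?thesis
    proof (cases "?Q = ?X")
      case True
      then have "paw_free j ?X" using fibre_paw_free[OF g good wV ij(2)] ne[OF wV] by simp
      then show ?thesis using card_bound_paw_free[OF bd[OF sub(2)] gX _ A] by simp
    next
      case False
      have QX': "?X = ?Q \<union> (?X - ?Q)" using QX by blast
      have "joined j ?Q (?X - ?Q)"
        unfolding joined_def
      proof (intro conjI ballI)
        fix y z assume yz: "y \<in> ?Q" "z \<in> ?X - ?Q"
        then have V: "y \<in> V" "z \<in> V" "f y \<noteq> f z" unfolding fibre_def nbrs_def by auto
        then have "c y z \<in> {i, j}" using g unfolding gallai_classes_def by blast
        moreover have "c y z \<noteq> i" using edge_freeD[OF ef, of y z] yz QX V by blast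
        ultimately show "c y z = j" by blast
      qed blast
      moreover have "?Q \<noteq> {}" using fibre_refl[OF wV] by blast
      moreover have "?X - ?Q \<noteq> {}" using False QX by blast
      moreover have "bounded ?Q" "bounded (?X - ?Q)"
        by (rule bounded_subset[OF bd[OF sub(2)]]; use QX in blast)+
      ultimately show ?thesis
        using card_bound_joined[of j ?Q "?X - ?Q" "A - {i}" B a] gX A QX' by simp
    qed
  qed
  have "card V \<le> card ?P + card ?X + card ?Y"
    using card_Un_le[of "?P \<union> ?X" ?Y] card_Un_le[of ?P ?X] cover by simp
  also have "\<dots> \<le> gallai_bound (Suc (Suc a)) (card B)"
    by (rule card_bound_two_books[of ?P ?X ?Y A B i j])
      (use good cover ij \<open>i \<noteq> j\<close> a ne[OF x(1)] bd sub x(2) X joined_fibre_nbrs[OF g x(1)] in simp_all)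
  finally show ?thesis unfolding a .
qed

text \<open>A class with an edge in \<open>i\<close> or \<open>j\<close> is handled by the preceding
  lemma. Otherwise both colours vanish inside all classes, each class has at most a 17th of the
  bound, and there are at most 17 classes.\<close>

lemma card_bound_classes_book_book:
  assumes g: "gallai_classes f V i j" and good: "good V A B"
    and ne: "\<And>x. x \<in> V \<Longrightarrow> nbrs f V i x \<noteq> {} \<and> nbrs f V j x \<noteq> {}"
    and bd: "\<And>X. X \<subset> V \<Longrightarrow> bounded X" and ij: "i \<in> A" "j \<in> A"
  shows "card V \<le> gallai_bound (card A) (card B)"
proof (cases "\<forall>x\<in>V. edge_free i (fibre f V x) \<and> edge_free j (fibre f V x)")
  case False
  then obtain x where "x \<in> V" "\<not> edge_free i (fibre f V x) \<or> \<not> edge_free j (fibre f V x)" by blast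
  then show ?thesis
    using card_bound_classes_edge[OF g good ne bd ij]
      card_bound_classes_edge[OF gallai_classes_sym[OF g] good _ bd ij(2,1)] ne by blast
next
  case True
  have "i \<noteq> j" and col: "\<forall>x\<in>V. \<forall>y\<in>V. f x \<noteq> f y \<longrightarrow> c x y \<in> {i, j}"
    using g unfolding gallai_classes_def by blast+
  show ?thesis
  proof (rule card_bound_representatives[of V 17 f i j])
    show "\<forall>x\<in>V. \<forall>y\<in>V. f x \<noteq> f y \<longrightarrow> c x y \<in> {i, j}" by (rule col)
    show "finite V" by (rule goodD(1)[OF good])
    show "card T \<le> 17" if "T \<subseteq> V" "coloured_in {i, j} T" for T
      using ramsey_book_book[OF _ that(2)] finite_subset[OF that(1) goodD(1)[OF good]]
        book_free_subset[OF goodD(7)[OF good ij(1)] that(1)]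
        book_free_subset[OF goodD(7)[OF good ij(2)] that(1)] by blast
    fix p assume "p \<in> f ` V"
    then obtain x where x: "x \<in> V" "p = f x" by blast
    have sub: "fibre f V x \<subset> V" using fibre_proper ne[OF x(1)] by blast
    have A: "card (A - {i}) = Suc (card (A - {i} - {j}))" "card A = Suc (Suc (card (A - {i} - {j})))"
      using ij \<open>i \<noteq> j\<close> goodD(2)[OF good] card_Suc_Diff1[of A i] card_Suc_Diff1[of "A - {i}" j] by simp_all
    have "good (fibre f V x) (A - {i}) B"
      by (rule good_edge_free_left[OF good_subset[OF good fibre_subset] _ ij(1)])
        (use True x(1) in blast)
    then have "card (fibre f V x) \<le> gallai_bound (card (A - {i} - {j})) (card B)"
      using card_bound_edge_free_left[OF bd[OF sub] _ _ _ A(1), of B j] True x(1) ij(2) \<open>i \<noteq> j\<close> by blast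
    then have "17 * card (fibre f V x) \<le> gallai_bound (card A) (card B)"
      unfolding A(2) gallai_bound_Suc_Suc by simp
    then have "17 * card {y \<in> V. f y = p} \<le> card {x} * gallai_bound (card A) (card B)"
      unfolding fibre_def x(2) by simp
    moreover have "{x} \<subseteq> {y \<in> V. f y = p}" using x by simp
    ultimately show "\<exists>T\<subseteq>{y \<in> V. f y = p}. coloured_in {i, j} T \<and>
        17 * card {y \<in> V. f y = p} \<le> card T * gallai_bound (card A) (card B)"
      using coloured_in_singleton by blast
  qed simp
qed

text \<open>Induction over proper subsets along a Gallai partition. If some class has no neighbours
  in one of the two colours, \<open>V\<close> splits in the other one; if not, both colours occur at
  every class, and whether \<open>i\<close> and \<open>j\<close> are book or triangle colours
  decides the case. \<open>k1\<close> and \<open>k2\<close> provide the two distinct colours for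
  \<open>gallai_partition\<close>.\<close>

theorem card_le_gallai_bound:
  assumes "k1 \<noteq> (k2 :: 'k)" "good V A B"
  shows "card V \<le> gallai_bound (card A) (card B)"
proof -
  have "finite V" by (rule goodD(1)[OF assms(2)])
  then show ?thesis using assms(2)
  proof (induction V arbitrary: A B rule: finite_psubset_induct)
    case (psubset V)
    have bd: "bounded X" if "X \<subset> V" for X
      unfolding bounded_def using psubset.IH that by blast
    show ?case
    proof (cases "card V \<ge> 2")
      case False
      then show ?thesis using gallai_bound_pos[of "card A" "card B"] by linarith
    next
      case True
      from gallai_partition[OF psubset.hyps True goodD(6)[OF psubset.prems] assms(1)]
      obtain f :: "'a \<Rightarrow> 'a" and i j where "i \<noteq> j" and two: "\<exists>x\<in>V. \<exists>y\<in>V. f x \<noteq> f y"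
        and "\<forall>x\<in>V. \<forall>y\<in>V. f x \<noteq> f y \<longrightarrow> c x y \<in> {i, j}"
        and "\<forall>x\<in>V. \<forall>x'\<in>V. \<forall>y\<in>V. f x = f x' \<longrightarrow> f x \<noteq> f y \<longrightarrow> c x y = c x' y"
        by (elim exE conjE)
      then have g: "gallai_classes f V i j" unfolding gallai_classes_def by (intro conjI)
      have split: "card V \<le> gallai_bound (card A) (card B)"
        if gc: "gallai_classes f V k l" and x: "x \<in> V" "nbrs f V l x = {}" for k l x
      proof -
        have V: "V = fibre f V x \<union> nbrs f V k x" using fibre_nbrs_cover[OF gc x(1)] x(2) by simp
        obtain y where "y \<in> V" "f y \<noteq> f x" using two by metis
        then have "fibre f V x \<noteq> V" unfolding fibre_def by blast
        then have ne: "nbrs f V k x \<noteq> {}" using V by force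
        have "good (fibre f V x \<union> nbrs f V k x) A B" using psubset.prems V by simp
        from card_bound_single_colour_split[OF joined_fibre_nbrs[OF gc x(1)] _ ne this
            bd[OF fibre_proper[OF ne]] bd[OF nbrs_proper[OF x(1)]]]
        show ?thesis using fibre_refl[OF x(1)] V by auto
      qed
      show ?thesis
      proof (cases "\<forall>x\<in>V. nbrs f V i x \<noteq> {} \<and> nbrs f V j x \<noteq> {}")
        case False
        then show ?thesis using split[OF g] split[OF gallai_classes_sym[OF g]] by blast
      next
        case True
        then have ne: "nbrs f V i x \<noteq> {} \<and> nbrs f V j x \<noteq> {}" "nbrs f V j x \<noteq> {} \<and> nbrs f V i x \<noteq> {}"
          if "x \<in> V" for x using that by blast+
        obtain x where x: "x \<in> V" using two by blast
        have "i \<in> A \<union> B" "j \<in> A \<union> B" using nbrs_colour[OF psubset.prems x] ne[OF x] by blast+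
        then consider "i \<in> A" "j \<in> A" | "i \<in> A" "j \<in> B" | "i \<in> B" "j \<in> A" | "i \<in> B" "j \<in> B" by blast
        then show ?thesis
        proof cases
          case 1
          show ?thesis by (rule card_bound_classes_book_book[OF g psubset.prems ne(1) bd 1])
        next
          case 2
          show ?thesis by (rule card_bound_classes_book_triangle[OF g psubset.prems ne(1) bd 2])
        next
          case 3
          show ?thesis
            by (rule card_bound_classes_book_triangle[OF gallai_classes_sym[OF g] psubset.prems ne(2) bd 3(2,1)])
        next
          case 4
          show ?thesis by (rule card_bound_classes_triangle_triangle[OF g psubset.prems ne(1) bd 4])
        qed
      qed
    qed
  qed
qed

end

section \<open>Lower bound\<close>

text \<open>The listed differences are the nonzero squares modulo 17. As -1 = 16 is a square, the
  absolute difference decides the colour.\<close>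

definition paley17 :: "nat \<Rightarrow> nat \<Rightarrow> bool" where
  "paley17 x y \<longleftrightarrow> (if x < y then y - x else x - y) \<in> {1, 2, 4, 8, 9, 13, 15, 16}"

lemma paley17_sym: "paley17 x y = paley17 y x"
  unfolding paley17_def by (cases x y rule: linorder_cases) simp_all

text \<open>Checked by evaluation over increasing quadruples; the fourth vertex is tried only if the
  first three form a monochromatic triangle.\<close>

lemma paley17_no_K4_sorted:
  "list_all (\<lambda>w. list_all (\<lambda>x. list_all (\<lambda>y.
     if paley17 w x = paley17 w y \<and> paley17 w x = paley17 x y
     then list_all (\<lambda>z. \<not> (paley17 w z = paley17 w x \<and> paley17 x z = paley17 w x \<and> paley17 y z = paley17 w x)) [Suc y..<17]
     else True) [Suc x..<17]) [Suc w..<17]) [0..<17]"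
  by code_simp

lemma paley17_no_K4:
  assumes "Q \<subseteq> {..<17}" "card Q = 4"
  shows "\<exists>x\<in>Q. \<exists>y\<in>Q. x \<noteq> y \<and> paley17 x y \<noteq> p"
proof (rule ccontr)
  assume neg: "\<not> ?thesis"
  have fin: "finite Q" using assms(1) finite_subset by blast
  obtain xs where xs: "xs = sorted_list_of_set Q" "length xs = 4" using fin assms(2) by simp
  from xs(2) obtain w x y z where "xs = [w, x, y, z]"
    by (auto simp: length_Suc_conv eval_nat_numeral)
  then have l: "sorted_list_of_set Q = [w, x, y, z]" using xs(1) by simp
  have "strict_sorted (sorted_list_of_set Q)" by simp
  then have ord: "w < x" "x < y" "y < z" unfolding l by simp_all
  have Q: "Q = {w, x, y, z}" using set_sorted_list_of_set[OF fin] unfolding l by simp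
  then have "z < 17" using assms(1) by simp
  have edge: "paley17 u v = p" if "u \<in> Q" "v \<in> Q" "u < v" for u v
    using neg that by (metis less_irrefl)
  have p: "paley17 w x = p" "paley17 w y = p" "paley17 x y = p" "paley17 w z = p" "paley17 x z = p"
    "paley17 y z = p"
    by (rule edge; use ord Q in simp)+
  have mem: "w \<in> set [0..<17]" "x \<in> set [Suc w..<17]" "y \<in> set [Suc x..<17]" "z \<in> set [Suc y..<17]"
    using ord \<open>z < 17\<close> by simp_all
  have "\<forall>z\<in>set [Suc y..<17].
      \<not> (paley17 w z = paley17 w x \<and> paley17 x z = paley17 w x \<and> paley17 y z = paley17 w x)"
    using bspec[OF bspec[OF bspec[OF paley17_no_K4_sorted[unfolded list_all_iff] mem(1)] mem(2)] mem(3)] p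
    by (simp only: simp_thms if_True)
  from bspec[OF this mem(4)] p show False by simp
qed

section \<open>Substitution into the Paley colouring\<close>

definition book_colouring :: "nat \<Rightarrow> nat \<Rightarrow> (nat \<Rightarrow> nat \<Rightarrow> nat) \<Rightarrow> bool" where
  "book_colouring r n d \<longleftrightarrow> sym_coloring d \<and> sym_coloring.good d {..<n} {1..r} {}"

text \<open>Vertex \<open>x\<close> stands for position \<open>x mod n\<close> in block
  \<open>x div n\<close>. Each block carries a copy of \<open>d\<close>, and the blocks are coloured
  among each other by the Paley colouring in two new colours.\<close>

definition blow_up :: "nat \<Rightarrow> nat \<Rightarrow> (nat \<Rightarrow> nat \<Rightarrow> nat) \<Rightarrow> nat \<Rightarrow> nat \<Rightarrow> nat" where
  "blow_up r n d x y = (if x div n = y div n then d (x mod n) (y mod n)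
     else if paley17 (x div n) (y div n) then Suc r else Suc (Suc r))"

text \<open>A vertex outside a block sees it in one colour, and between three blocks only two
  colours occur, so no triangle is rainbow. A \<open>B_3^+\<close> in an old colour would lie in one
  block; one in a new colour would contain a \<open>K_4\<close> with its vertices in four different
  blocks.\<close>

lemma book_colouring_blow_up:
  assumes "book_colouring r n d" "n > 0"
  shows "book_colouring (Suc (Suc r)) (17 * n) (blow_up r n d)"
proof -
  interpret d: sym_coloring d using assms(1) unfolding book_colouring_def by blast
  interpret e: sym_coloring "blow_up r n d"
  proof
    show "blow_up r n d x y = blow_up r n d y x" for x y
      unfolding blow_up_def using d.c_sym[of "x mod n" "y mod n"] paley17_sym[of "x div n" "y div n"]
      by presburger
  qed
  have good: "d.good {..<n} {1..r} {}" using assms(1) unfolding book_colouring_def by blast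
  have mod: "x mod n \<in> {..<n}" for x using assms(2) by simp
  have mod_ne: "x mod n \<noteq> y mod n" if "x div n = y div n" "x \<noteq> y" for x y
    using that by (metis div_mult_mod_eq)
  have inner: "d (x mod n) (y mod n) \<in> {1..r}" if "x div n = y div n" "x \<noteq> y" for x y
    using d.coloured_inD[OF d.goodD(5)[OF good] mod mod mod_ne[OF that]] by simp
  have "e.coloured_in {1..Suc (Suc r)} {..<17 * n}"
    unfolding e.coloured_in_def blow_up_def using inner by force
  moreover have "e.no_rainbow {..<17 * n}"
    unfolding e.no_rainbow_def
  proof (intro ballI impI)
    fix x y z :: nat assume "distinct [x, y, z]"
    then have ne: "x \<noteq> y" "y \<noteq> z" "x \<noteq> z" by auto
    show "blow_up r n d x y = blow_up r n d y z \<or> blow_up r n d y z = blow_up r n d x z \<or>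
      blow_up r n d x y = blow_up r n d x z"
    proof (cases "x div n = y div n \<and> y div n = z div n")
      case True
      then have eq: "x div n = y div n" "y div n = z div n" "x div n = z div n" by simp_all
      show ?thesis
        using d.no_rainbowD[OF d.goodD(6)[OF good] mod mod mod mod_ne[OF eq(1) ne(1)]
            mod_ne[OF eq(2) ne(2)] mod_ne[OF eq(3) ne(3)]]
        by (simp add: blow_up_def eq)
    next
      case False
      then consider "x div n = y div n" "y div n \<noteq> z div n" | "y div n = z div n" "x div n \<noteq> z div n"
        | "x div n = z div n" "y div n \<noteq> z div n"
        | "x div n \<noteq> y div n" "y div n \<noteq> z div n" "x div n \<noteq> z div n"
        by metis
      then show ?thesis
      proof cases
        case 3
        then have "blow_up r n d y x = blow_up r n d y z" by (simp add: blow_up_def)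
        then have "blow_up r n d x y = blow_up r n d y z" using e.c_sym by metis
        then show ?thesis by blast
      next
        case 4
        then show ?thesis by (simp add: blow_up_def)
      qed (simp_all add: blow_up_def)
    qed
  qed
  moreover have "e.book_free k {..<17 * n}" for k
    unfolding e.book_free_def
  proof (intro ballI impI notI)
    fix a b x y z assume V: "a \<in> {..<17 * n}" "b \<in> {..<17 * n}" "x \<in> {..<17 * n}" "y \<in> {..<17 * n}"
      and "distinct [a, b, x, y, z]"
      and book: "blow_up r n d a b = k \<and> blow_up r n d a x = k \<and> blow_up r n d a y = k \<and>
        blow_up r n d a z = k \<and> blow_up r n d b x = k \<and> blow_up r n d b y = k \<and>
        blow_up r n d b z = k \<and> blow_up r n d x y = k"
    then have ne: "a \<noteq> b" "a \<noteq> x" "a \<noteq> y" "a \<noteq> z" "b \<noteq> x" "b \<noteq> y" "b \<noteq> z" "x \<noteq> y" "x \<noteq> z" "y \<noteq> z"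
      by auto
    have old: "u div n = v div n" if "blow_up r n d u v = k" "k \<in> {1..r}" for u v
      using that unfolding blow_up_def by (auto split: if_splits)
    have new: "u div n \<noteq> v div n \<and> paley17 (u div n) (v div n) = (k = Suc r)"
      if "blow_up r n d u v = k" "k \<notin> {1..r}" "u \<noteq> v" for u v
      using that inner[of u v] unfolding blow_up_def by (auto split: if_splits)
    show False
    proof (cases "k \<in> {1..r}")
      case True
      have div: "a div n = b div n" "a div n = x div n" "a div n = y div n" "a div n = z div n"
        by (rule old[OF _ True]; use book in simp)+
      have "d (u mod n) (v mod n) = k" if "blow_up r n d u v = k" "u div n = v div n" for u v
        using that unfolding blow_up_def by simp
      note inner_edge = this
      have "d (a mod n) (b mod n) = k" "d (a mod n) (x mod n) = k" "d (a mod n) (y mod n) = k"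
        "d (a mod n) (z mod n) = k" "d (b mod n) (x mod n) = k" "d (b mod n) (y mod n) = k"
        "d (b mod n) (z mod n) = k" "d (x mod n) (y mod n) = k"
        by (rule inner_edge; use book div in simp)+
      moreover have "distinct [a mod n, b mod n, x mod n, y mod n, z mod n]"
        using ne div mod_ne[of a b] mod_ne[of a x] mod_ne[of a y] mod_ne[of a z] mod_ne[of b x]
          mod_ne[of b y] mod_ne[of b z] mod_ne[of x y] mod_ne[of x z] mod_ne[of y z] by simp
      moreover have "{a mod n, b mod n, x mod n, y mod n, z mod n} \<subseteq> {..<n}" using mod by simp
      ultimately show False using d.book_freeD[OF d.goodD(7)[OF good True]] by blast
    next
      case False
      let ?Q = "{a div n, b div n, x div n, y div n}"
      have div: "a div n \<noteq> b div n" "a div n \<noteq> x div n" "a div n \<noteq> y div n" "b div n \<noteq> x div n"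
        "b div n \<noteq> y div n" "x div n \<noteq> y div n"
        and pal: "paley17 (a div n) (b div n) = (k = Suc r)" "paley17 (a div n) (x div n) = (k = Suc r)"
        "paley17 (a div n) (y div n) = (k = Suc r)" "paley17 (b div n) (x div n) = (k = Suc r)"
        "paley17 (b div n) (y div n) = (k = Suc r)" "paley17 (x div n) (y div n) = (k = Suc r)"
        by (rule new[OF _ False, THEN conjunct1] new[OF _ False, THEN conjunct2]; use book ne in simp)+
      have "?Q \<subseteq> {..<17}" using V by (simp add: less_mult_imp_div_less)
      moreover have "card ?Q = 4" using div by simp
      ultimately have "\<exists>u\<in>?Q. \<exists>v\<in>?Q. u \<noteq> v \<and> paley17 u v \<noteq> (k = Suc r)"
        by (rule paley17_no_K4)
      then show False using pal pal[THEN trans[OF paley17_sym]] by (elim bexE insertE emptyE; simp)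
    qed
  qed
  ultimately have "e.good {..<17 * n} {1..Suc (Suc r)} {}"
    unfolding e.good_def by simp
  then show ?thesis unfolding book_colouring_def using e.sym_coloring_axioms by blast
qed

text \<open>\<open>B_3^+\<close> has five vertices, so at most four vertices leave no room for it;
  once there is an edge, colour 1 has to be available. This provides the start values 1 and 4 of
  \<open>book_factor\<close>.\<close>

lemma book_colouring_constant:
  assumes "n \<le> 4" "n \<le> 1 \<or> r \<ge> 1"
  shows "book_colouring r n (\<lambda>_ _. 1)"
proof -
  interpret e: sym_coloring "\<lambda>_ _. 1 :: nat" by unfold_locales simp
  have "e.book_free k {..<n}" for k
    unfolding e.book_free_def
  proof (intro ballI impI notI)
    fix a b x y z assume "a \<in> {..<n}" "b \<in> {..<n}" "x \<in> {..<n}" "y \<in> {..<n}" "z \<in> {..<n}"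
      and d: "distinct [a, b, x, y, z]"
    then have "set [a, b, x, y, z] \<subseteq> {..<n}" by simp
    then have "card (set [a, b, x, y, z]) \<le> n" using card_mono[of "{..<n}"] by fastforce
    then show False using distinct_card[OF d] assms(1) by simp
  qed
  then have "e.good {..<n} {1..r} {}"
    using assms unfolding e.good_def e.coloured_in_def e.no_rainbow_def by auto
  then show ?thesis unfolding book_colouring_def using e.sym_coloring_axioms by blast
qed

lemma book_colouring_exists: "\<exists>d. book_colouring r (book_factor r) d"
proof (induction r rule: book_factor.induct)
  case 1
  then show ?case using book_colouring_constant[of 1 0] by auto
next
  case 2
  then show ?case using book_colouring_constant[of 4 1] by auto
next
  case (3 r)
  then obtain d where "book_colouring r (book_factor r) d" by blast
  moreover have "book_factor r > 0" using book_factor_pos[of r] by simp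
  ultimately show ?case using book_colouring_blow_up by auto
qed

lemma book_colouring_mono: "book_colouring r n d \<Longrightarrow> m \<le> n \<Longrightarrow> book_colouring r m d"
  unfolding book_colouring_def using sym_coloring.good_subset[of d "{..<n}" _ _ "{..<m}"] by auto

section \<open>Translation from the graph-theoretic definitions\<close>

lemma has_mono_copy_book3_plus_iff:
  "has_mono_copy r V c book3_plus \<longleftrightarrow> (\<exists>k\<in>{1..r}. \<exists>a\<in>V. \<exists>b\<in>V. \<exists>x\<in>V. \<exists>y\<in>V. \<exists>z\<in>V.
     distinct [a, b, x, y, z] \<and> c {a, b} = k \<and> c {a, x} = k \<and> c {a, y} = k \<and> c {a, z} = k \<and>
     c {b, x} = k \<and> c {b, y} = k \<and> c {b, z} = k \<and> c {x, y} = k)" (is "?L \<longleftrightarrow> ?R")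
proof
  assume ?L
  then obtain k and f :: "nat \<Rightarrow> 'a" where k: "k \<in> {1..r}" and inj: "inj_on f {0, 1, 2, 3, 4}"
    and V: "f ` {0, 1, 2, 3, 4} \<subseteq> V" and col: "\<forall>e\<in>edges book3_plus. c (f ` e) = k"
    unfolding has_mono_copy_def verts_book3_plus by (elim bexE exE conjE)
  have "c {f 0, f 1} = k \<and> c {f 0, f 2} = k \<and> c {f 0, f 3} = k \<and> c {f 0, f 4} = k \<and>
     c {f 1, f 2} = k \<and> c {f 1, f 3} = k \<and> c {f 1, f 4} = k \<and> c {f 2, f 3} = k"
    using col unfolding edges_book3_plus by simp
  moreover have "distinct [f 0, f 1, f 2, f 3, f 4]" using inj by simp
  moreover have "f 0 \<in> V" "f 1 \<in> V" "f 2 \<in> V" "f 3 \<in> V" "f 4 \<in> V" using V by simp_all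
  ultimately show ?R
    by (intro bexI[OF _ k] bexI[of _ "f 0"] bexI[of _ "f 1"] bexI[of _ "f 2"] bexI[of _ "f 3"]
        bexI[of _ "f 4"] conjI) simp_all
next
  assume ?R
  then obtain k a b x y z where k: "k \<in> {1..r}" and V: "a \<in> V" "b \<in> V" "x \<in> V" "y \<in> V" "z \<in> V"
    and d: "distinct [a, b, x, y, z]"
    and col: "c {a, b} = k" "c {a, x} = k" "c {a, y} = k" "c {a, z} = k"
      "c {b, x} = k" "c {b, y} = k" "c {b, z} = k" "c {x, y} = k"
    by (elim bexE conjE)
  \<comment> \<open>The positions follow the vertex names of \<open>book3_plus\<close>: 0 and 1 form
    the spine, 2 and 3 the extra edge, 4 is the third page.\<close>
  let ?f = "\<lambda>m::nat. [a, b, x, y, z] ! m"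
  have "inj_on ?f {0, 1, 2, 3, 4}" using d by simp
  moreover have "?f ` {0, 1, 2, 3, 4} \<subseteq> V" using V by simp
  moreover have "\<forall>e\<in>edges book3_plus. c (?f ` e) = k" using col unfolding edges_book3_plus by simp
  ultimately show ?L unfolding has_mono_copy_def verts_book3_plus using k by blast
qed

text \<open>Passes from colourings of two-element sets to symmetric functions of two arguments; all
  \<open>r\<close> colours are book colours and none is a triangle colour.\<close>

lemma gallai_coloring_avoiding_iff:
  assumes "finite V"
  shows "gallai_coloring r V c \<and> \<not> has_mono_copy r V c book3_plus \<longleftrightarrow>
    sym_coloring.good (\<lambda>x y. c {x, y}) V {1..r} {}"
proof -
  interpret sym_coloring "\<lambda>x y. c {x, y}" by unfold_locales (simp add: insert_commute)
  have "c \<in> edges (complete_graph V) \<rightarrow> {1..r} \<longleftrightarrow> coloured_in {1..r} V"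
    unfolding edges_def complete_graph_def coloured_in_def snd_conv nsets_2_eq Pi_iff ball_UN
    by auto
  moreover have "\<not> (\<exists>x\<in>V. \<exists>y\<in>V. \<exists>z\<in>V. rainbow_triangle c x y z) \<longleftrightarrow> no_rainbow V"
    unfolding rainbow_triangle_def no_rainbow_def by (simp, blast)
  moreover have "\<not> has_mono_copy r V c book3_plus \<longleftrightarrow> (\<forall>k\<in>{1..r}. book_free k V)"
    unfolding has_mono_copy_book3_plus_iff book_free_def
    by (simp only: bex_simps(8) de_Morgan_conj imp_conv_disj)
  ultimately show ?thesis unfolding gallai_coloring_def good_def using assms by auto
qed

theorem theorem2:
  fixes r :: nat
  assumes "r \<ge> 1"
  shows "gallai_ramsey r book3_plus =
           (if even r then 17 ^ (r div 2) + 1 else 4 * 17 ^ ((r - 1) div 2) + 1)"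
proof -
  have "gallai_ramsey r book3_plus = book_factor r + 1"
    unfolding gallai_ramsey_def
  proof (rule Least_equality)
    show "\<forall>c. gallai_coloring r {..<book_factor r + 1} c \<longrightarrow>
      has_mono_copy r {..<book_factor r + 1} c book3_plus"
    proof (intro allI impI, rule ccontr)
      fix c assume "gallai_coloring r {..<book_factor r + 1} c"
        "\<not> has_mono_copy r {..<book_factor r + 1} c book3_plus"
      then have good: "sym_coloring.good (\<lambda>x y. c {x, y}) {..<book_factor r + 1} {1..r} {}"
        using gallai_coloring_avoiding_iff[of "{..<book_factor r + 1}" r c] by simp
      interpret sym_coloring "\<lambda>x y. c {x, y}" by unfold_locales (simp add: insert_commute)
      \<comment> \<open>With \<open>B = {}\<close> the factor for triangle colours is 1, so the
        bound is \<open>book_factor r\<close>, one less than the number of vertices.\<close>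
      show False
        using card_le_gallai_bound[OF zero_neq_one good] by (simp add: gallai_bound_def)
    qed
  next
    fix n :: nat assume n: "\<forall>c. gallai_coloring r {..<n} c \<longrightarrow> has_mono_copy r {..<n} c book3_plus"
    show "book_factor r + 1 \<le> n"
    proof (rule ccontr)
      assume "\<not> ?thesis"
      then have "n \<le> book_factor r" by simp
      then obtain d where d: "book_colouring r n d"
        using book_colouring_exists book_colouring_mono by blast
      interpret sym_coloring d using d unfolding book_colouring_def by blast
      \<comment> \<open>Minimum and maximum recover the two ends of an edge; by symmetry of
        \<open>d\<close> their order does not matter.\<close>
      let ?c = "\<lambda>e. d (Min e) (Max e)"
      have "(\<lambda>x y. ?c {x, y}) = d"
        by (intro ext) (simp add: min_def max_def c_sym)
      then have "gallai_coloring r {..<n} ?c \<and> \<not> has_mono_copy r {..<n} ?c book3_plus"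
        using gallai_coloring_avoiding_iff[of "{..<n}" r ?c] d unfolding book_colouring_def by simp
      then show False using n by blast
    qed
  qed
  then show ?thesis by (simp add: book_factor_eq)
qed

end
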